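(* Assume, in addition to the setting below, that at least one of the following holds: (H1) $f$ is differentiable on $\mathbb{R}^m$ with $L$-Lipschitz continuous gradient for some $L>0$; (H2) the restriction of $A$ to $\mathcal{M}(\Omega_0)$ is surjective onto $\mathbb{R}^m$. Then there is a subsequence of $(\mu_k,q_k)_{k\in\mathbb{N}}$ along which $\mu_k$ converges weak-$*$ (in $\mathcal{M}(\Omega)=\mathcal{C}_0(\Omega)^*$) to some $\mu_\infty$ and $q_k$ converges in $\mathbb{R}^m$ to some $q_\infty$, where $\mu_\infty$ solves $(\mathcal{P})$, $q_\infty$ solves $(\mathcal{D})$, and $J(\mu_k)\to J(\mu_\infty)=\inf(\mathcal{P})$ along this subsequence. If the solution of $(\mathcal{P})$ (respectively of $(\mathcal{D})$) is unique, then the whole sequence $(\mu_k)$ (respectively $(q_k)$) converges to it.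
   Context: Let $d,m\ge 1$ and let $\Omega\subseteq\mathbb{R}^d$ be a nonempty open set. $\mathcal{M}(\Omega)$ is the space of finite signed Radon measures on $\Omega$ with total variation norm $\|\cdot\|_{\mathcal{M}}$, identified with the dual of $\mathcal{C}_0(\Omega)$ (continuous functions vanishing at infinity, with sup-norm $\|\cdot\|_\infty$). For $\Omega'\subseteq\Omega$, $\mathcal{M}(\Omega')$ denotes the measures in $\mathcal{M}(\Omega)$ supported in $\Omega'$. Fix $a_1,\dots,a_m\in\mathcal{C}_0(\Omega)$; let $A:\mathcal{M}(\Omega)\to\mathbb{R}^m$, $(A\mu)_i=\int_\Omega a_i\,d\mu$, and for $q\in\mathbb{R}^m$ let $A^*q=\sum_{i=1}^m q_i a_i\in\mathcal{C}_0(\Omega)$. Let $f:\mathbb{R}^m\to\mathbb{R}\cup\{+\infty\}$ be proper, convex, lower semicontinuous and bounded from below, with convex conjugate $f^*(q)=\sup_{y}\langle q,y\rangle-f(y)$. Put $J(\mu)=\|\mu\|_{\mathcal{M}}+f(A\mu)$. For $\Omega'\subseteq\Omega$, $(\mathcal{P}(\Omega'))$ is the problem $\inf_{\mu\in\mathcal{M}(\Omega')}J(\mu)$ and $(\mathcal{D}(\Omega'))$ is $\sup\{-f^*(q):q\in\mathbb{R}^m,\ |A^*q(x)|\le 1\ \forall x\in\Omega'\}$; $(\mathcal{P})=(\mathcal{P}(\Omega))$ and $(\mathcal{D})=(\mathcal{D}(\Omega))$. Standing assumption: for $\Omega'=\Omega$ and for each $\Omega'=\Omega_k$ below, both problems admit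 solutions and their optimal values coincide (no duality gap). Exchange algorithm: a set $\Omega_0\subseteq\Omega$ is given; for $k\ge 0$, $\mu_k$ is a solution of $(\mathcal{P}(\Omega_k))$, $q_k$ a solution of $(\mathcal{D}(\Omega_k))$, $X_k$ is the set of all local maximizers $x\in\Omega$ of $|A^*q_k|$ with $|A^*q_k(x)|>1$, and $\Omega_{k+1}=\Omega_k\cup X_k$. *)

theory Defs
  imports "HOL-Analysis.Analysis" "HOL-Probability.Probability"
begin

(* A finite signed Radon (= finite signed Borel) measure on an open set \<Omega> of a
   Euclidean space, represented by its Jordan decomposition (mu_plus, mu_minus):
   two finite positive Borel measures on the ambient space, concentrated on \<Omega>,
   mutually singular.  This representation is unique, so equality of pairs is
   equality of signed measures. *)
type_synonym 'a smeasure = "'a measure \<times> 'a measure"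

definition is_smeasure :: "'a::euclidean_space set \<Rightarrow> 'a smeasure \<Rightarrow> bool" where
  "is_smeasure \<Omega> \<mu> \<longleftrightarrow>
     sets (fst \<mu>) = sets borel \<and> sets (snd \<mu>) = sets borel \<and>
     finite_measure (fst \<mu>) \<and> finite_measure (snd \<mu>) \<and>
     emeasure (fst \<mu>) (- \<Omega>) = 0 \<and> emeasure (snd \<mu>) (- \<Omega>) = 0 \<and>
     (\<exists>P \<in> sets borel. emeasure (fst \<mu>) (- P) = 0 \<and> emeasure (snd \<mu>) P = 0)"

definition tv_norm :: "'a::euclidean_space smeasure \<Rightarrow> real" where
  "tv_norm \<mu> = measure (fst \<mu>) UNIV + measure (snd \<mu>) UNIV"

definition sintegral :: "('a::euclidean_space \<Rightarrow> real) \<Rightarrow> 'a smeasure \<Rightarrow> real" where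
  "sintegral a \<mu> = (\<integral>x. a x \<partial>(fst \<mu>)) - (\<integral>x. a x \<partial>(snd \<mu>))"

definition supported_in :: "'a::euclidean_space set \<Rightarrow> 'a smeasure \<Rightarrow> bool" where
  "supported_in \<Omega>' \<mu> \<longleftrightarrow>
     (\<exists>N \<in> sets borel. - \<Omega>' \<subseteq> N \<and> emeasure (fst \<mu>) N = 0 \<and> emeasure (snd \<mu>) N = 0)"

definition Meas :: "'a::euclidean_space set \<Rightarrow> 'a set \<Rightarrow> 'a smeasure set" where
  "Meas \<Omega> \<Omega>' = {\<mu>. is_smeasure \<Omega> \<mu> \<and> supported_in \<Omega>' \<mu>}"

(* C_0(\<Omega>): continuous on \<Omega>, vanishing at infinity (i.e. at the boundary of \<Omega>
   and at \<infinity>); extended by 0 outside \<Omega>. *)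
definition C0 :: "'a::euclidean_space set \<Rightarrow> ('a \<Rightarrow> real) set" where
  "C0 \<Omega> = {a. continuous_on \<Omega> a \<and>
               (\<forall>e>0. \<exists>K. compact K \<and> K \<subseteq> \<Omega> \<and> (\<forall>x\<in>\<Omega> - K. \<bar>a x\<bar> < e)) \<and>
               (\<forall>x. x \<notin> \<Omega> \<longrightarrow> a x = 0)}"

definition weakstar_conv :: "'a::euclidean_space set \<Rightarrow> (nat \<Rightarrow> 'a smeasure) \<Rightarrow> 'a smeasure \<Rightarrow> bool" where
  "weakstar_conv \<Omega> \<mu>s \<mu> \<longleftrightarrow>
     (\<forall>\<phi> \<in> C0 \<Omega>. (\<lambda>n. sintegral \<phi> (\<mu>s n)) \<longlonglongrightarrow> sintegral \<phi> \<mu>)"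

definition opA :: "('m::finite \<Rightarrow> 'a::euclidean_space \<Rightarrow> real) \<Rightarrow> 'a smeasure \<Rightarrow> real^'m" where
  "opA a \<mu> = (\<chi> i. sintegral (a i) \<mu>)"

definition opAadj :: "('m::finite \<Rightarrow> 'a::euclidean_space \<Rightarrow> real) \<Rightarrow> real^'m \<Rightarrow> 'a \<Rightarrow> real" where
  "opAadj a q = (\<lambda>x. \<Sum>i\<in>UNIV. q $ i * a i x)"

definition proper_fun :: "('b \<Rightarrow> ereal) \<Rightarrow> bool" where
  "proper_fun f \<longleftrightarrow> (\<forall>y. f y \<noteq> -\<infinity>) \<and> (\<exists>y. f y \<noteq> \<infinity>)"

definition convex_ext :: "('b::real_vector \<Rightarrow> ereal) \<Rightarrow> bool" where
  "convex_ext f \<longleftrightarrow> (\<forall>x y. \<forall>t::real. 0 < t \<and> t < 1 \<longrightarrow>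
       f ((1 - t) *\<^sub>R x + t *\<^sub>R y) \<le> ereal (1 - t) * f x + ereal t * f y)"

definition lsc_ext :: "('b::topological_space \<Rightarrow> ereal) \<Rightarrow> bool" where
  "lsc_ext f \<longleftrightarrow> (\<forall>y c. c < f y \<longrightarrow> (\<forall>\<^sub>F z in nhds y. c < f z))"

definition conj_fun :: "(real^'m::finite \<Rightarrow> ereal) \<Rightarrow> real^'m \<Rightarrow> ereal" where
  "conj_fun f q = (SUP y. ereal (q \<bullet> y) - f y)"

definition Jfun :: "('m::finite \<Rightarrow> 'a::euclidean_space \<Rightarrow> real) \<Rightarrow> (real^'m \<Rightarrow> ereal)
                    \<Rightarrow> 'a smeasure \<Rightarrow> ereal" where
  "Jfun a f \<mu> = ereal (tv_norm \<mu>) + f (opA a \<mu>)"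

definition val_P :: "'a::euclidean_space set \<Rightarrow> ('m::finite \<Rightarrow> 'a \<Rightarrow> real) \<Rightarrow> (real^'m \<Rightarrow> ereal)
                     \<Rightarrow> 'a set \<Rightarrow> ereal" where
  "val_P \<Omega> a f \<Omega>' = (INF \<mu> \<in> Meas \<Omega> \<Omega>'. Jfun a f \<mu>)"

definition solves_P :: "'a::euclidean_space set \<Rightarrow> ('m::finite \<Rightarrow> 'a \<Rightarrow> real) \<Rightarrow> (real^'m \<Rightarrow> ereal)
                     \<Rightarrow> 'a set \<Rightarrow> 'a smeasure \<Rightarrow> bool" where
  "solves_P \<Omega> a f \<Omega>' \<mu> \<longleftrightarrow> \<mu> \<in> Meas \<Omega> \<Omega>' \<and> (\<forall>\<nu> \<in> Meas \<Omega> \<Omega>'. Jfun a f \<mu> \<le> Jfun a f \<nu>)"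

definition feas_D :: "('m::finite \<Rightarrow> 'a::euclidean_space \<Rightarrow> real) \<Rightarrow> 'a set \<Rightarrow> (real^'m) set" where
  "feas_D a \<Omega>' = {q. \<forall>x \<in> \<Omega>'. \<bar>opAadj a q x\<bar> \<le> 1}"

definition val_D :: "('m::finite \<Rightarrow> 'a::euclidean_space \<Rightarrow> real) \<Rightarrow> (real^'m \<Rightarrow> ereal)
                     \<Rightarrow> 'a set \<Rightarrow> ereal" where
  "val_D a f \<Omega>' = (SUP q \<in> feas_D a \<Omega>'. - conj_fun f q)"

definition solves_D :: "('m::finite \<Rightarrow> 'a::euclidean_space \<Rightarrow> real) \<Rightarrow> (real^'m \<Rightarrow> ereal)
                     \<Rightarrow> 'a set \<Rightarrow> real^'m \<Rightarrow> bool" where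
  "solves_D a f \<Omega>' q \<longleftrightarrow> q \<in> feas_D a \<Omega>' \<and>
      (\<forall>p \<in> feas_D a \<Omega>'. - conj_fun f p \<le> - conj_fun f q)"

definition standing :: "'a::euclidean_space set \<Rightarrow> ('m::finite \<Rightarrow> 'a \<Rightarrow> real) \<Rightarrow> (real^'m \<Rightarrow> ereal)
                     \<Rightarrow> 'a set \<Rightarrow> bool" where
  "standing \<Omega> a f \<Omega>' \<longleftrightarrow> (\<exists>\<mu>. solves_P \<Omega> a f \<Omega>' \<mu>) \<and> (\<exists>q. solves_D a f \<Omega>' q) \<and>
                          val_P \<Omega> a f \<Omega>' = val_D a f \<Omega>'"

definition local_max_in :: "'a::metric_space set \<Rightarrow> ('a \<Rightarrow> real) \<Rightarrow> 'a \<Rightarrow> bool" where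
  "local_max_in \<Omega> g x \<longleftrightarrow> x \<in> \<Omega> \<and> (\<exists>e>0. \<forall>y \<in> \<Omega> \<inter> ball x e. g y \<le> g x)"

definition exch_X :: "'a::euclidean_space set \<Rightarrow> ('m::finite \<Rightarrow> 'a \<Rightarrow> real) \<Rightarrow> real^'m \<Rightarrow> 'a set" where
  "exch_X \<Omega> a q = {x. local_max_in \<Omega> (\<lambda>y. \<bar>opAadj a q y\<bar>) x \<and> \<bar>opAadj a q x\<bar> > 1}"

end

theory Submission
  imports Defs
begin

text \<open>
  Bounded sequences of signed measures have weak-* convergent subsequences along which the norm is
  lower semicontinuous. A bounded subset of \<open>\<real>\<^sup>d\<close> has an injective Borel code in \<open>[0,1]\<close> whose
  inverse extends continuously, so that on bounded sets this is Helly's selection theorem on the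
  line; a homeomorphism of \<open>\<real>\<^sup>d\<close> with the unit ball carries it over to open sets, where mass may be
  lost at the boundary.

  The optimal values \<open>J(\<mu>\<^sub>k) = -f\<^sup>*(q\<^sub>k)\<close> decrease to some \<open>V \<ge> inf(P)\<close>. The \<open>q\<^sub>k\<close> are bounded: under
  H1, \<open>f\<close> is bounded on the unit ball and hence \<open>f\<^sup>*(q) \<ge> \<bar>q\<bar> - C\<close>; under H2 one tests with measures
  on \<open>\<Omega>\<^sub>0\<close> that are mapped to the unit vectors. If \<open>\<bar>A\<^sup>*q\<^sub>k\<bar>\<close> exceeds 1, its maximizer enters
  \<open>\<Omega>\<^sub>k\<^sub>+\<^sub>1\<close>, so \<open>sup \<bar>A\<^sup>*q\<^sub>k\<bar> \<le> 1 + C \<bar>q\<^sub>k - q\<^sub>l\<bar>\<close> for all \<open>l > k\<close>, and every cluster point \<open>q\<close> is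
  feasible for (D). By lower semicontinuity \<open>V \<le> -f\<^sup>*(q) \<le> sup(D) = inf(P) \<le> V\<close>, and \<open>J(\<mu>) \<le> V\<close>
  for every weak-* limit \<open>\<mu>\<close>.
\<close>

section \<open>Ternary codes\<close>

lemma ternary_tail_sums: "(\<lambda>k. 2 / 3 ^ Suc (k + n) :: real) sums (1 / 3 ^ n)"
  using sums_mult[OF geometric_sums[of "1 / 3 :: real"], of "2 / 3 ^ Suc n"]
  by (simp add: power_add field_simps)

lemma summable_ternary:
  fixes d :: "nat \<Rightarrow> real"
  assumes "\<And>n. \<bar>d n\<bar> \<le> 1"
  shows "summable (\<lambda>k. d (k + n) * (2 / 3 ^ Suc (k + n)))"
  using assms
  by (intro summable_comparison_test'[OF sums_summable[OF ternary_tail_sums[of n]], of 0])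
    (simp add: abs_mult divide_right_mono)

lemma abs_ternary_tail_le:
  fixes d :: "nat \<Rightarrow> real"
  assumes "\<And>n. \<bar>d n\<bar> \<le> 1"
  shows "\<bar>\<Sum>k. d (k + n) * (2 / 3 ^ Suc (k + n))\<bar> \<le> 1 / 3 ^ n"
proof -
  have "norm (d (k + n) * (2 / 3 ^ Suc (k + n))) \<le> 2 / 3 ^ Suc (k + n)" for k
    using assms[of "k + n"] by (simp add: abs_mult divide_right_mono)
  from norm_suminf_le[OF this sums_summable[OF ternary_tail_sums]] show ?thesis
    by (simp add: sums_unique[OF ternary_tail_sums])
qed

lemma abs_ternary_sum_ge:
  fixes d :: "nat \<Rightarrow> real"
  assumes bounded: "\<And>n. \<bar>d n\<bar> \<le> 1" and "\<And>i. i < n \<Longrightarrow> d i = 0" and "\<bar>d n\<bar> = 1"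
  shows "1 / 3 ^ Suc n \<le> \<bar>\<Sum>k. d k * (2 / 3 ^ Suc k)\<bar>"
proof -
  let ?t = "\<lambda>k. d k * (2 / 3 ^ Suc k)"
  have "(\<Sum>i<Suc n. ?t i) = ?t n"
    using assms(2) by (simp add: sum.neutral)
  moreover have "summable ?t"
    using summable_ternary[of d 0, OF bounded] by simp
  ultimately have split: "suminf ?t = (\<Sum>k. ?t (k + Suc n)) + ?t n"
    using suminf_split_initial_segment[of ?t "Suc n"] by simp
  have "2 * (1 / 3 ^ Suc n) = \<bar>?t n\<bar>"
    using \<open>\<bar>d n\<bar> = 1\<close> by (simp add: abs_mult)
  also have "\<dots> \<le> \<bar>suminf ?t\<bar> + \<bar>\<Sum>k. ?t (k + Suc n)\<bar>"
    using abs_triangle_ineq4[of "suminf ?t" "\<Sum>k. ?t (k + Suc n)"]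
    by (simp only: split add_diff_cancel_left')
  also have "\<bar>\<Sum>k. ?t (k + Suc n)\<bar> \<le> 1 / 3 ^ Suc n"
    by (rule abs_ternary_tail_le[OF bounded])
  finally show ?thesis by simp
qed

definition ternary_code :: "(nat \<Rightarrow> 'a set) \<Rightarrow> 'a \<Rightarrow> real" where
  "ternary_code B x = (\<Sum>n. indicator (B n) x * (2 / 3 ^ Suc n))"

lemma summable_ternary_code: "summable (\<lambda>n. indicator (B n) x * (2 / 3 ^ Suc n) :: real)"
  using summable_ternary[of "\<lambda>n. indicator (B n) x" 0] by (simp add: indicator_def)

lemma ternary_code_nonneg: "0 \<le> ternary_code B x"
  unfolding ternary_code_def by (rule suminf_nonneg[OF summable_ternary_code]) simp

lemma ternary_code_le_1: "ternary_code B x \<le> 1"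
  using abs_ternary_tail_le[of "\<lambda>n. indicator (B n) x" 0]
  by (simp add: ternary_code_def indicator_def)

lemma borel_measurable_ternary_code:
  assumes [measurable]: "\<And>n. B n \<in> sets M"
  shows "ternary_code B \<in> borel_measurable M"
  unfolding ternary_code_def by measurable

lemma ternary_code_close_imp_same_members:
  assumes close: "\<bar>ternary_code B x - ternary_code B y\<bar> < 1 / 3 ^ N" and "n < N"
  shows "x \<in> B n \<longleftrightarrow> y \<in> B n"
proof (rule ccontr)
  define d :: "nat \<Rightarrow> real" where "d i = indicator (B i) x - indicator (B i) y" for i
  let ?differ = "\<lambda>i. (x \<in> B i) \<noteq> (y \<in> B i)"
  define m where "m = (LEAST i. ?differ i)"
  assume "\<not> (x \<in> B n \<longleftrightarrow> y \<in> B n)"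
  then have "?differ n" by blast
  then have "?differ m" and "m \<le> n"
    unfolding m_def by (rule LeastI, rule Least_le)
  have "?differ i \<longrightarrow> \<not> i < m" for i
    unfolding m_def using not_less_Least by blast
  then have "1 / 3 ^ Suc m \<le> \<bar>\<Sum>k. d k * (2 / 3 ^ Suc k)\<bar>"
    using \<open>?differ m\<close> by (intro abs_ternary_sum_ge) (auto simp: d_def indicator_def)
  also have "(\<Sum>k. d k * (2 / 3 ^ Suc k)) = ternary_code B x - ternary_code B y"
    unfolding ternary_code_def suminf_diff[OF summable_ternary_code summable_ternary_code] d_def
    by (simp only: left_diff_distrib)
  also have "\<bar>\<dots>\<bar> < 1 / 3 ^ N"
    by (rule close)
  also have "1 / 3 ^ N \<le> (1 / 3 ^ Suc m :: real)"
    using \<open>m \<le> n\<close> \<open>n < N\<close> by (intro divide_left_mono power_increasing) auto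
  finally show False by simp
qed

lemma ternary_code_inverse_uniform:
  fixes S :: "'a::metric_space set"
  assumes B_open: "\<And>n. open (B n)" and B_basis: "\<And>U x. open U \<Longrightarrow> x \<in> U \<Longrightarrow> \<exists>n. x \<in> B n \<and> B n \<subseteq> U"
    and "compact S" "0 < e"
  obtains \<delta> where "0 < \<delta>"
    "\<And>x y. x \<in> S \<Longrightarrow> \<bar>ternary_code B x - ternary_code B y\<bar> < \<delta> \<Longrightarrow> dist x y < e"
proof -
  have "\<exists>n. z \<in> B n \<and> B n \<subseteq> ball z (e / 2)" for z
    using \<open>0 < e\<close> by (intro B_basis) auto
  then obtain n where n: "\<And>z. z \<in> B (n z)" "\<And>z. B (n z) \<subseteq> ball z (e / 2)"
    by metis
  then have "S \<subseteq> (\<Union>z\<in>S. B (n z))"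
    by blast
  then obtain F where "finite F" and cover: "S \<subseteq> (\<Union>z\<in>F. B (n z))"
    using compactE_image[OF \<open>compact S\<close>, of S "\<lambda>z. B (n z)"] B_open by metis
  obtain N where N: "\<And>z. z \<in> F \<Longrightarrow> n z < N"
    using finite_nat_set_iff_bounded[of "n ` F"] \<open>finite F\<close> by auto
  show thesis
  proof
    fix x y
    assume "x \<in> S" and close: "\<bar>ternary_code B x - ternary_code B y\<bar> < 1 / 3 ^ N"
    then obtain z where "z \<in> F" "x \<in> B (n z)"
      using cover by blast
    moreover from this have "y \<in> B (n z)"
      using ternary_code_close_imp_same_members[OF close N] by blast
    ultimately have "dist z x < e / 2" "dist z y < e / 2"
      using n(2)[of z] by auto
    then show "dist x y < e"
      by (metis dist_commute dist_triangle_half_l)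
  qed simp
qed

lemma ternary_code_uniformly_continuous_inverse:
  fixes S :: "'a::metric_space set"
  assumes B: "\<And>n. open (B n)" "\<And>U x. open U \<Longrightarrow> x \<in> U \<Longrightarrow> \<exists>n. x \<in> B n \<and> B n \<subseteq> U"
    and "compact S"
  shows "inj_on (ternary_code B) S"
    and "uniformly_continuous_on (ternary_code B ` S) (inv_into S (ternary_code B))"
proof -
  let ?s = "ternary_code B"
  have uniform: "\<exists>\<delta>>0. \<forall>x\<in>S. \<forall>y\<in>S. \<bar>?s x - ?s y\<bar> < \<delta> \<longrightarrow> dist x y < e" if "0 < e" for e
    using ternary_code_inverse_uniform[OF B \<open>compact S\<close> that] by metis
  show inj: "inj_on ?s S"
  proof (intro inj_onI)
    fix x y assume "x \<in> S" "y \<in> S" "?s x = ?s y"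
    then have "dist x y < e" if "0 < e" for e
      using uniform[OF that] by fastforce
    then show "x = y"
      using zero_less_dist_iff by blast
  qed
  show "uniformly_continuous_on (?s ` S) (inv_into S ?s)"
    unfolding uniformly_continuous_on_def
    using uniform by (force simp: inj dist_real_def dist_commute)
qed

lemma uniformly_continuous_on_extends_to_UNIV:
  fixes f :: "'a::{metric_space,second_countable_topology} \<Rightarrow> 'b::euclidean_space"
  assumes "uniformly_continuous_on S f"
  obtains g where "continuous_on UNIV g" "\<And>x. x \<in> S \<Longrightarrow> g x = f x"
proof -
  obtain h where h: "uniformly_continuous_on (closure S) h" "\<And>x. x \<in> S \<Longrightarrow> f x = h x"
    using uniformly_continuous_on_extension_on_closure[OF assms] by metis
  then obtain g where "continuous_on UNIV g" "\<And>x. x \<in> closure S \<Longrightarrow> g x = h x"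
    using Tietze_unbounded[of "closure S" h UNIV]
    by (auto simp: uniformly_continuous_imp_continuous)
  then show thesis
    using that h(2) closure_subset[of S] by (metis subsetD)
qed

lemma bounded_set_Borel_code:
  fixes S :: "'a::euclidean_space set"
  assumes "bounded S"
  obtains s :: "'a \<Rightarrow> real" and c :: "real \<Rightarrow> 'a"
  where "s \<in> borel_measurable borel" "range s \<subseteq> {0..1}" "continuous_on UNIV c"
    "\<And>x. x \<in> S \<Longrightarrow> c (s x) = x"
proof -
  obtain B :: "nat \<Rightarrow> 'a set" where B_open: "\<And>n. open (B n)"
    and basis: "\<And>U. open U \<Longrightarrow> \<exists>k. U = \<Union>(B ` k)"
    by (metis Setcompr_eq_image that univ_second_countable_sequence)
  have B_basis: "\<exists>n. x \<in> B n \<and> B n \<subseteq> U" if "open U" "x \<in> U" for U x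
    using basis[OF \<open>open U\<close>] \<open>x \<in> U\<close> by blast
  let ?s = "ternary_code B"
  have "compact (closure S)"
    using \<open>bounded S\<close> by (simp add: compact_closure)
  note inverse = ternary_code_uniformly_continuous_inverse[OF B_open B_basis this]
  obtain c where c: "continuous_on UNIV c"
    "\<And>t. t \<in> ?s ` closure S \<Longrightarrow> c t = inv_into (closure S) ?s t"
    using uniformly_continuous_on_extends_to_UNIV[OF inverse(2)] by metis
  show thesis
  proof
    show "?s \<in> borel_measurable borel"
      using B_open by (intro borel_measurable_ternary_code) auto
    show "range ?s \<subseteq> {0..1}"
      by (auto simp: ternary_code_nonneg ternary_code_le_1)
    show "c (?s x) = x" if "x \<in> S" for x
      using that closure_subset[of S] by (auto simp: c(2) inverse(1))
  qed (rule c)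
qed

section \<open>Weak compactness on bounded sets\<close>

lemma tight_if_concentrated:
  assumes "\<And>n. real_distribution (\<sigma> n)" "a < b" "\<And>n. measure (\<sigma> n) {a<..b} = 1"
  shows "tight \<sigma>"
  unfolding tight_def using assms by (intro conjI allI impI exI[of _ a] exI[of _ b]) simp_all

text \<open>With a Borel code \<open>s\<close> and its continuous left inverse \<open>c\<close>, the limit of \<open>\<rho>\<^sub>n\<close> is the image
  under \<open>c\<close> of a Helly limit of the images of \<open>\<rho>\<^sub>n\<close> under \<open>s\<close>.\<close>

theorem prob_weak_subsequence:
  fixes \<rho> :: "nat \<Rightarrow> 'a::euclidean_space measure"
  assumes "bounded S" and prob: "\<And>n. prob_space (\<rho> n)"
    and [measurable_cong]: "\<And>n. sets (\<rho> n) = sets borel"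
    and concentrated: "\<And>n. AE x in \<rho> n. x \<in> S"
  obtains r M where "strict_mono (r :: nat \<Rightarrow> nat)" "prob_space M" "sets M = sets borel"
    "\<And>(\<phi> :: 'a \<Rightarrow> real) B. continuous_on UNIV \<phi> \<Longrightarrow> (\<And>x. \<bar>\<phi> x\<bar> \<le> B) \<Longrightarrow>
      (\<lambda>n. \<integral>x. \<phi> x \<partial>\<rho> (r n)) \<longlonglongrightarrow> (\<integral>x. \<phi> x \<partial>M)"
proof -
  obtain s :: "'a \<Rightarrow> real" and c where [measurable]: "s \<in> borel_measurable borel"
    and s_range: "range s \<subseteq> {0..1}" and c: "continuous_on UNIV c" "\<And>x. x \<in> S \<Longrightarrow> c (s x) = x"
    using bounded_set_Borel_code[OF \<open>bounded S\<close>] by metis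
  have [measurable]: "c \<in> borel_measurable borel"
    using c(1) by (rule borel_measurable_continuous_onI)
  define \<sigma> where "\<sigma> n = distr (\<rho> n) borel s" for n
  have \<sigma>: "real_distribution (\<sigma> n)" for n
    unfolding \<sigma>_def by (rule prob_space.real_distribution_distr[OF prob]) simp
  have "s -` {-1<..1} = UNIV"
    using s_range by (force simp: image_subset_iff)
  then have "measure (\<sigma> n) {-1<..1} = 1" for n
    using prob_space.prob_space[OF prob[of n]] by (simp add: \<sigma>_def measure_distr)
  then have "tight \<sigma>"
    by (intro tight_if_concentrated[OF \<sigma>, of "-1" 1]) simp_all
  then obtain r N where r: "strict_mono r"
    and N: "real_distribution N" "weak_conv_m (\<lambda>n. \<sigma> (r n)) N"
    using tight_imp_convergent_subsubsequence[OF \<open>tight \<sigma>\<close> strict_mono_id] by (auto simp: comp_def)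
  interpret N: real_distribution N by (rule N)
  show thesis
  proof
    show "strict_mono r" by (rule r)
    show "prob_space (distr N borel c)" by (rule N.prob_space_distr) simp
    fix \<phi> :: "'a \<Rightarrow> real" and B
    assume \<phi>: "continuous_on UNIV \<phi>" "\<And>x. \<bar>\<phi> x\<bar> \<le> B"
    have [measurable]: "\<phi> \<in> borel_measurable borel"
      using \<phi>(1) by (rule borel_measurable_continuous_onI)
    have "(\<integral>x. \<phi> (c (s x)) \<partial>\<rho> n) = (\<integral>x. \<phi> x \<partial>\<rho> n)" for n
      using concentrated[of n] by (intro integral_cong_AE) (auto simp: c(2))
    then have "(\<integral>t. \<phi> (c t) \<partial>\<sigma> n) = (\<integral>x. \<phi> x \<partial>\<rho> n)" for n
      unfolding \<sigma>_def by (simp add: integral_distr)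
    moreover have "continuous_on UNIV (\<lambda>t. \<phi> (c t))"
      using continuous_on_compose2[OF \<phi>(1) c(1)] by simp
    then have "(\<lambda>n. \<integral>t. \<phi> (c t) \<partial>\<sigma> (r n)) \<longlonglongrightarrow> (\<integral>t. \<phi> (c t) \<partial>N)"
      using \<sigma> N \<phi>(2)
      by (intro weak_conv_imp_integral_bdd_continuous_conv[of _ _ _ B])
        (auto simp: continuous_on_eq_continuous_at)
    ultimately show "(\<lambda>n. \<integral>x. \<phi> x \<partial>\<rho> (r n)) \<longlonglongrightarrow> (\<integral>x. \<phi> x \<partial>distr N borel c)"
      by (simp add: integral_distr)
  qed simp
qed

section \<open>Functions vanishing at infinity\<close>

lemma C0_small_off_compact:
  assumes "\<phi> \<in> C0 \<Omega>" "0 < e"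
  obtains K where "compact K" "K \<subseteq> \<Omega>" "\<And>x. x \<notin> K \<Longrightarrow> \<bar>\<phi> x\<bar> < e"
proof -
  obtain K where K: "compact K" "K \<subseteq> \<Omega>" "\<forall>x\<in>\<Omega> - K. \<bar>\<phi> x\<bar> < e"
    using assms unfolding C0_def by blast
  moreover have "\<bar>\<phi> x\<bar> < e" if "x \<notin> K" for x
    using assms K(3) that by (cases "x \<in> \<Omega>") (auto simp: C0_def)
  ultimately show thesis using that by blast
qed

lemma C0_zero_outside: "\<phi> \<in> C0 \<Omega> \<Longrightarrow> x \<notin> \<Omega> \<Longrightarrow> \<phi> x = 0"
  by (simp add: C0_def)

lemma C0_continuous_on: "\<phi> \<in> C0 \<Omega> \<Longrightarrow> continuous_on \<Omega> \<phi>"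
  by (simp add: C0_def)

lemma C0I:
  assumes "continuous_on \<Omega> \<phi>" "\<And>x. x \<notin> \<Omega> \<Longrightarrow> \<phi> x = 0"
    and "\<And>e. 0 < e \<Longrightarrow> \<exists>K. compact K \<and> K \<subseteq> \<Omega> \<and> (\<forall>x. x \<notin> K \<longrightarrow> \<bar>\<phi> x\<bar> < e)"
  shows "\<phi> \<in> C0 \<Omega>"
  unfolding C0_def mem_Collect_eq
proof (intro conjI allI impI)
  show "\<exists>K. compact K \<and> K \<subseteq> \<Omega> \<and> (\<forall>x\<in>\<Omega> - K. \<bar>\<phi> x\<bar> < e)" if "0 < e" for e
    using assms(3)[OF that] by (meson DiffD2)
qed (use assms in auto)

lemma C0_continuous_on_UNIV:
  assumes "open \<Omega>" "\<phi> \<in> C0 \<Omega>"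
  shows "continuous_on UNIV \<phi>"
proof (intro continuous_at_imp_continuous_on ballI)
  fix x
  show "isCont \<phi> x"
  proof (cases "x \<in> \<Omega>")
    case True
    then show ?thesis
      using assms C0_continuous_on continuous_on_eq_continuous_at by blast
  next
    case False
    have "(\<phi> \<longlongrightarrow> 0) (at x)"
    proof (rule tendstoI)
      fix e :: real assume "0 < e"
      then obtain K where K: "compact K" "K \<subseteq> \<Omega>" "\<And>y. y \<notin> K \<Longrightarrow> \<bar>\<phi> y\<bar> < e"
        using C0_small_off_compact[OF \<open>\<phi> \<in> C0 \<Omega>\<close>] by metis
      then have "open (- K)" "x \<in> - K"
        using False compact_imp_closed by auto
      then have "\<forall>\<^sub>F y in at x. y \<in> - K"
        by (auto simp: eventually_at_topological)
      then show "\<forall>\<^sub>F y in at x. dist (\<phi> y) 0 < e"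
        by eventually_elim (simp add: K(3))
    qed
    then show ?thesis
      by (simp add: isCont_def C0_zero_outside[OF assms(2) False])
  qed
qed

lemma borel_measurable_C0:
  "open \<Omega> \<Longrightarrow> \<phi> \<in> C0 \<Omega> \<Longrightarrow> \<phi> \<in> borel_measurable borel"
  by (intro borel_measurable_continuous_onI C0_continuous_on_UNIV)

lemma C0_abs_attains_max:
  assumes \<phi>: "\<phi> \<in> C0 \<Omega>" and "\<phi> x \<noteq> 0"
  obtains y where "y \<in> \<Omega>" "\<And>z. \<bar>\<phi> z\<bar> \<le> \<bar>\<phi> y\<bar>"
proof -
  obtain K where K: "compact K" "K \<subseteq> \<Omega>" "\<And>z. z \<notin> K \<Longrightarrow> \<bar>\<phi> z\<bar> < \<bar>\<phi> x\<bar>"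
    using C0_small_off_compact[OF \<phi>, of "\<bar>\<phi> x\<bar>"] \<open>\<phi> x \<noteq> 0\<close> by auto
  have "x \<in> K"
    using K(3)[of x] by blast
  moreover have "continuous_on K (\<lambda>z. \<bar>\<phi> z\<bar>)"
    using continuous_on_subset[OF C0_continuous_on[OF \<phi>] \<open>K \<subseteq> \<Omega>\<close>] by (intro continuous_intros)
  ultimately obtain y where "y \<in> K" and y: "\<And>z. z \<in> K \<Longrightarrow> \<bar>\<phi> z\<bar> \<le> \<bar>\<phi> y\<bar>"
    using continuous_attains_sup[OF \<open>compact K\<close>] by blast
  have "\<bar>\<phi> z\<bar> \<le> \<bar>\<phi> y\<bar>" for z
    using K(3)[of z] y[of z] y[OF \<open>x \<in> K\<close>] by fastforce
  then show thesis
    using that \<open>y \<in> K\<close> \<open>K \<subseteq> \<Omega>\<close> by blast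
qed

lemma C0_bounded:
  assumes "\<phi> \<in> C0 \<Omega>"
  shows "\<exists>B. \<forall>x. \<bar>\<phi> x\<bar> \<le> B"
proof (cases "\<exists>x. \<phi> x \<noteq> 0")
  case True
  then show ?thesis
    using C0_abs_attains_max[OF assms] by metis
qed auto

lemma C0_add:
  assumes \<phi>: "\<phi> \<in> C0 \<Omega>" and \<psi>: "\<psi> \<in> C0 \<Omega>"
  shows "(\<lambda>x. \<phi> x + \<psi> x) \<in> C0 \<Omega>"
proof (rule C0I)
  fix e :: real assume "0 < e"
  then have "0 < e / 2" by simp
  obtain K where K: "compact K" "K \<subseteq> \<Omega>" "\<And>x. x \<notin> K \<Longrightarrow> \<bar>\<phi> x\<bar> < e / 2"
    using C0_small_off_compact[OF \<phi> \<open>0 < e / 2\<close>] by metis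
  obtain L where L: "compact L" "L \<subseteq> \<Omega>" "\<And>x. x \<notin> L \<Longrightarrow> \<bar>\<psi> x\<bar> < e / 2"
    using C0_small_off_compact[OF \<psi> \<open>0 < e / 2\<close>] by metis
  have "\<bar>\<phi> x + \<psi> x\<bar> < e" if "x \<notin> K \<union> L" for x
    using K(3)[of x] L(3)[of x] that by auto
  then show "\<exists>K. compact K \<and> K \<subseteq> \<Omega> \<and> (\<forall>x. x \<notin> K \<longrightarrow> \<bar>\<phi> x + \<psi> x\<bar> < e)"
    using K(1,2) L(1,2) by (intro exI[of _ "K \<union> L"]) (auto intro: compact_Un)
qed (use assms in \<open>auto simp: C0_def intro: continuous_on_add\<close>)

lemma C0_mult_left:
  assumes \<phi>: "\<phi> \<in> C0 \<Omega>"
  shows "(\<lambda>x. t * \<phi> x) \<in> C0 \<Omega>"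
proof (rule C0I)
  fix e :: real assume "0 < e"
  then have "0 < e / (\<bar>t\<bar> + 1)" by simp
  then obtain K where K: "compact K" "K \<subseteq> \<Omega>" "\<And>x. x \<notin> K \<Longrightarrow> \<bar>\<phi> x\<bar> < e / (\<bar>t\<bar> + 1)"
    using C0_small_off_compact[OF \<phi>] by metis
  have "\<bar>t * \<phi> x\<bar> < e" if "x \<notin> K" for x
  proof -
    have "\<bar>t * \<phi> x\<bar> \<le> (\<bar>t\<bar> + 1) * \<bar>\<phi> x\<bar>"
      by (simp add: abs_mult mult_right_mono)
    also have "\<dots> < e"
      using K(3)[OF that] by (simp add: field_simps)
    finally show ?thesis .
  qed
  then show "\<exists>K. compact K \<and> K \<subseteq> \<Omega> \<and> (\<forall>x. x \<notin> K \<longrightarrow> \<bar>t * \<phi> x\<bar> < e)"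
    using K(1,2) by blast
qed (use assms in \<open>auto simp: C0_def intro: continuous_on_mult_left\<close>)

lemma C0_zero: "(\<lambda>x. 0) \<in> C0 \<Omega>"
  by (rule C0I) auto

lemma C0_sum: "(\<And>i. i \<in> I \<Longrightarrow> \<phi> i \<in> C0 \<Omega>) \<Longrightarrow> (\<lambda>x. \<Sum>i\<in>I. \<phi> i x) \<in> C0 \<Omega>"
  by (induction I rule: infinite_finite_induct) (simp_all add: C0_zero C0_add)

lemma C0_homeomorphic_image:
  assumes hom: "homeomorphism \<Omega> \<Omega>' j k" and \<phi>: "\<phi> \<in> C0 \<Omega>"
  shows "(\<lambda>y. indicator \<Omega>' y * \<phi> (k y)) \<in> C0 \<Omega>'"
proof (rule C0I)
  have "continuous_on \<Omega>' (\<lambda>y. \<phi> (k y))"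
    using hom
    by (intro continuous_on_compose2[OF C0_continuous_on[OF \<phi>]]) (auto simp: homeomorphism_def)
  then show "continuous_on \<Omega>' (\<lambda>y. indicator \<Omega>' y * \<phi> (k y))"
    by (rule continuous_on_eq) simp
  fix e :: real assume "0 < e"
  then obtain K where K: "compact K" "K \<subseteq> \<Omega>" "\<And>x. x \<notin> K \<Longrightarrow> \<bar>\<phi> x\<bar> < e"
    using C0_small_off_compact[OF \<phi>] by metis
  have "compact (j ` K)" "j ` K \<subseteq> \<Omega>'"
    using hom K
    by (auto simp: homeomorphism_def intro: compact_continuous_image continuous_on_subset)
  moreover have "k y \<notin> K" if "y \<in> \<Omega>'" "y \<notin> j ` K" for y
    using that hom by (metis homeomorphism_apply2 imageI)
  then have "\<bar>indicator \<Omega>' y * \<phi> (k y)\<bar> < e" if "y \<notin> j ` K" for y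
    using that K(3) \<open>0 < e\<close> by (simp add: indicator_def)
  ultimately show "\<exists>K. compact K \<and> K \<subseteq> \<Omega>' \<and> (\<forall>y. y \<notin> K \<longrightarrow> \<bar>indicator \<Omega>' y * \<phi> (k y)\<bar> < e)"
    by blast
qed simp

lemma integrable_C0:
  fixes M :: "'a::euclidean_space measure"
  assumes "finite_measure M" "sets M = sets borel" "open \<Omega>" "\<phi> \<in> C0 \<Omega>"
  shows "integrable M \<phi>"
proof -
  obtain B where "\<And>x. \<bar>\<phi> x\<bar> \<le> B"
    using C0_bounded[OF \<open>\<phi> \<in> C0 \<Omega>\<close>] by blast
  moreover have "\<phi> \<in> borel_measurable M"
    using borel_measurable_C0[OF assms(3,4)] assms(2) by (simp cong: measurable_cong_sets)
  ultimately show ?thesis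
    using assms(1) by (intro finite_measure.integrable_const_bound[of M _ B]) auto
qed

section \<open>Weak-* compactness\<close>

definition vague_conv :: "'a::euclidean_space set \<Rightarrow> (nat \<Rightarrow> 'a measure) \<Rightarrow> 'a measure \<Rightarrow> bool" where
  "vague_conv \<Omega> Ms M \<longleftrightarrow> (\<forall>\<phi>\<in>C0 \<Omega>. (\<lambda>n. \<integral>x. \<phi> x \<partial>Ms n) \<longlonglongrightarrow> (\<integral>x. \<phi> x \<partial>M))"

lemma vague_conv_subseq:
  "vague_conv \<Omega> Ms M \<Longrightarrow> strict_mono r \<Longrightarrow> vague_conv \<Omega> (\<lambda>n. Ms (r n)) M"
  using LIMSEQ_subseq_LIMSEQ by (fastforce simp: vague_conv_def comp_def)

lemma homeomorphic_pullback_measure: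
  fixes M :: "'b::euclidean_space measure" and k :: "'b \<Rightarrow> 'a::euclidean_space"
  assumes hom: "homeomorphism \<Omega> \<Omega>' j k" and "open \<Omega>" "open \<Omega>'"
    and "finite_measure M" and sets_M [measurable_cong]: "sets M = sets borel"
  obtains P where "finite_measure P" "sets P = sets borel" "emeasure P (- \<Omega>) = 0"
    "measure P UNIV \<le> measure M UNIV"
    "\<And>\<phi>. \<phi> \<in> C0 \<Omega> \<Longrightarrow> (\<integral>x. \<phi> x \<partial>P) = (\<integral>y\<in>\<Omega>'. \<phi> (k y) \<partial>M)"
proof -
  interpret M: finite_measure M by fact
  have space_M: "space M = UNIV"
    using sets_eq_imp_space_eq[OF sets_M] by simp
  have [measurable]: "\<Omega>' \<in> sets M"
    using \<open>open \<Omega>'\<close> by (simp add: sets_M)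
  have "k \<in> borel_measurable (restrict_space borel \<Omega>')"
    using hom by (intro borel_measurable_continuous_on_restrict) (simp add: homeomorphism_def)
  then have [measurable]: "k \<in> borel_measurable (restrict_space M \<Omega>')"
    using measurable_cong_sets[OF sets_restrict_space_cong[OF sets_M] refl] by blast
  interpret R: finite_measure "restrict_space M \<Omega>'"
    by (rule finite_measure_restrict_space) (rule M.finite_measure_axioms, simp)
  define P where "P = distr (restrict_space M \<Omega>') borel k"
  show thesis
  proof
    show "finite_measure P"
      unfolding P_def by (rule R.finite_measure_distr) simp
    show "sets P = sets borel"
      by (simp add: P_def)
    have "k -` (- \<Omega>) \<inter> \<Omega>' = {}"
      using hom by (auto simp: homeomorphism_def)
    then show "emeasure P (- \<Omega>) = 0"
      using \<open>open \<Omega>\<close> by (simp add: P_def emeasure_distr space_restrict_space space_M)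
    show "measure P UNIV \<le> measure M UNIV"
      by (simp add: P_def measure_distr space_restrict_space space_M measure_restrict_space
          M.finite_measure_mono sets_M \<open>open \<Omega>'\<close>)
    fix \<phi> assume \<phi>: "\<phi> \<in> C0 \<Omega>"
    note [measurable] = borel_measurable_C0[OF \<open>open \<Omega>\<close> \<phi>]
    show "(\<integral>x. \<phi> x \<partial>P) = (\<integral>y\<in>\<Omega>'. \<phi> (k y) \<partial>M)"
      unfolding P_def set_lebesgue_integral_def
      by (simp add: integral_distr integral_restrict_space space_M)
  qed
qed

lemma open_set_homeomorphic_in_ball:
  fixes \<Omega> :: "'a::euclidean_space set"
  assumes "open \<Omega>"
  obtains j k :: "'a \<Rightarrow> 'a" where "homeomorphism UNIV (ball 0 1) j k"
    "homeomorphism \<Omega> (j ` \<Omega>) j k" "open (j ` \<Omega>)"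
proof -
  have "(UNIV :: 'a set) homeomorphic ball (0::'a) 1"
    by (rule homeomorphic_sym[THEN iffD1, OF homeomorphic_ball01_UNIV])
  then obtain j k :: "'a \<Rightarrow> 'a" where jk: "homeomorphism UNIV (ball 0 1) j k"
    unfolding homeomorphic_def by blast
  moreover have "homeomorphism \<Omega> (j ` \<Omega>) j k"
    by (rule homeomorphism_of_subsets[OF jk subset_UNIV subset_refl refl])
  moreover have "openin (top_of_set (ball 0 1)) (j ` \<Omega>)"
    using homeomorphism_imp_open_map[OF jk, of \<Omega>] \<open>open \<Omega>\<close> by simp
  then have "open (j ` \<Omega>)"
    by (rule openin_open_trans) simp
  ultimately show thesis by (rule that)
qed

lemma integral_distr_homeomorphism:
  fixes j :: "'a::euclidean_space \<Rightarrow> 'b::euclidean_space"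
  assumes jk: "homeomorphism UNIV T j k" and "open (j ` \<Omega>)"
    and [measurable_cong]: "sets M = sets borel" and \<phi>: "\<phi> \<in> C0 \<Omega>"
  shows "(\<integral>y\<in>j ` \<Omega>. \<phi> (k y) \<partial>distr M borel j) = (\<integral>x. \<phi> x \<partial>M)"
proof -
  have hom: "homeomorphism \<Omega> (j ` \<Omega>) j k"
    using jk by (rule homeomorphism_of_subsets) auto
  have [measurable]: "j \<in> borel_measurable borel"
    using homeomorphism_cont1[OF jk] by (rule borel_measurable_continuous_onI)
  note [measurable] = borel_measurable_C0[OF \<open>open (j ` \<Omega>)\<close> C0_homeomorphic_image[OF hom \<phi>]]
  have "indicator (j ` \<Omega>) (j x) * \<phi> (k (j x)) = \<phi> x" for x
    using homeomorphism_apply1[OF jk] C0_zero_outside[OF \<phi>, of x] by (force simp: indicator_def)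
  then show ?thesis
    by (simp add: set_lebesgue_integral_def integral_distr)
qed

lemma prob_vague_subsequence:
  fixes \<rho> :: "nat \<Rightarrow> 'a::euclidean_space measure"
  assumes "open \<Omega>" and prob: "\<And>n. prob_space (\<rho> n)"
    and sets_\<rho> [measurable_cong]: "\<And>n. sets (\<rho> n) = sets borel"
  obtains r P where "strict_mono (r :: nat \<Rightarrow> nat)" "finite_measure P" "sets P = sets borel"
    "emeasure P (- \<Omega>) = 0" "measure P UNIV \<le> 1" "vague_conv \<Omega> (\<lambda>n. \<rho> (r n)) P"
proof -
  obtain j k :: "'a \<Rightarrow> 'a" where jk: "homeomorphism UNIV (ball 0 1) j k"
    and hom: "homeomorphism \<Omega> (j ` \<Omega>) j k" and open_image: "open (j ` \<Omega>)"
    using open_set_homeomorphic_in_ball[OF \<open>open \<Omega>\<close>] by metis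
  have [measurable]: "j \<in> borel_measurable borel"
    using homeomorphism_cont1[OF jk] by (rule borel_measurable_continuous_onI)
  obtain r M where r: "strict_mono (r :: nat \<Rightarrow> nat)" and "prob_space M" and "sets M = sets borel"
    and conv: "\<And>(\<phi> :: 'a \<Rightarrow> real) B. continuous_on UNIV \<phi> \<Longrightarrow> (\<And>x. \<bar>\<phi> x\<bar> \<le> B) \<Longrightarrow>
      (\<lambda>n. \<integral>x. \<phi> x \<partial>distr (\<rho> (r n)) borel j) \<longlonglongrightarrow> (\<integral>x. \<phi> x \<partial>M)"
  proof (rule prob_weak_subsequence[of "ball 0 1" "\<lambda>n. distr (\<rho> n) borel j"])
    show "prob_space (distr (\<rho> n) borel j)" for n
      by (rule prob_space.prob_space_distr[OF prob]) simp
    have "j x \<in> ball 0 1" for x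
      using jk by (auto simp: homeomorphism_def)
    then show "AE y in distr (\<rho> n) borel j. y \<in> ball 0 1" for n
      by (subst AE_distr_iff) auto
  qed (auto intro: that)
  interpret M: prob_space M by fact
  obtain P where P: "finite_measure P" "sets P = sets borel" "emeasure P (- \<Omega>) = 0"
    "measure P UNIV \<le> measure M UNIV"
    "\<And>\<phi>. \<phi> \<in> C0 \<Omega> \<Longrightarrow> (\<integral>x. \<phi> x \<partial>P) = (\<integral>y\<in>j ` \<Omega>. \<phi> (k y) \<partial>M)"
    by (rule homeomorphic_pullback_measure[OF hom \<open>open \<Omega>\<close> open_image M.finite_measure_axioms
          \<open>sets M = sets borel\<close>]) (rule that)
  have "vague_conv \<Omega> (\<lambda>n. \<rho> (r n)) P"
    unfolding vague_conv_def
  proof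
    fix \<phi> assume \<phi>: "\<phi> \<in> C0 \<Omega>"
    have \<phi>_image: "(\<lambda>y. indicator (j ` \<Omega>) y * \<phi> (k y)) \<in> C0 (j ` \<Omega>)"
      by (rule C0_homeomorphic_image[OF hom \<phi>])
    then obtain B where "\<And>y. \<bar>indicator (j ` \<Omega>) y * \<phi> (k y)\<bar> \<le> B"
      using C0_bounded by blast
    from conv[OF C0_continuous_on_UNIV[OF open_image \<phi>_image] this]
    have "(\<lambda>n. \<integral>y\<in>j ` \<Omega>. \<phi> (k y) \<partial>distr (\<rho> (r n)) borel j) \<longlonglongrightarrow> (\<integral>y\<in>j ` \<Omega>. \<phi> (k y) \<partial>M)"
      by (simp add: set_lebesgue_integral_def)
    then show "(\<lambda>n. \<integral>x. \<phi> x \<partial>\<rho> (r n)) \<longlonglongrightarrow> (\<integral>x. \<phi> x \<partial>P)"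
      by (simp add: P(5)[OF \<phi>] integral_distr_homeomorphism[OF jk open_image sets_\<rho> \<phi>])
  qed
  then show thesis
    using that[OF r P(1-3)] P(4) M.prob_le_1[of UNIV] by linarith
qed

lemma finite_measure_normalized:
  assumes "finite_measure M" "space M \<noteq> {}"
  shows "\<exists>\<rho>. prob_space \<rho> \<and> sets \<rho> = sets M \<and>
    (\<forall>\<phi> :: 'a \<Rightarrow> real. \<phi> \<in> borel_measurable M \<longrightarrow>
      (\<integral>x. \<phi> x \<partial>M) = measure M (space M) * (\<integral>x. \<phi> x \<partial>\<rho>))"
proof (cases "measure M (space M) = 0")
  case True
  interpret finite_measure M by fact
  obtain x where "x \<in> space M"
    using assms(2) by blast
  have "space M \<in> null_sets M"
    using True by (simp add: null_sets_def emeasure_eq_measure)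
  then have "(\<integral>x. \<phi> x \<partial>M) = 0" for \<phi> :: "'a \<Rightarrow> real"
    by (simp add: integral_eq_zero_AE AE_I')
  then show ?thesis
    using True prob_space_return[OF \<open>x \<in> space M\<close>] by (intro exI[of _ "return M x"]) simp
next
  case False
  interpret finite_measure M by fact
  let ?c = "measure M (space M)"
  have "0 < ?c"
    using False by (simp add: zero_less_measure_iff)
  let ?\<rho> = "density M (\<lambda>_. ennreal (1 / ?c))"
  have "emeasure ?\<rho> (space ?\<rho>) = 1"
    using \<open>0 < ?c\<close> by (simp add: emeasure_density emeasure_eq_measure ennreal_mult'[symmetric])
  then have "prob_space ?\<rho>"
    by (rule prob_spaceI)
  moreover have "(\<integral>x. \<phi> x \<partial>M) = ?c * (\<integral>x. \<phi> x \<partial>?\<rho>)" if "\<phi> \<in> borel_measurable M" for \<phi> :: "'a \<Rightarrow> real"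
    using \<open>0 < ?c\<close> that by (simp add: integral_density)
  ultimately show ?thesis
    by (intro exI[of _ ?\<rho>]) simp
qed

lemma vague_conv_scaled:
  assumes "open \<Omega>" "finite_measure P" "sets P = sets borel" and conv: "vague_conv \<Omega> \<rho> P"
    and c: "c \<longlonglongrightarrow> m" "0 \<le> m"
    and scaled: "\<And>n \<phi>. \<phi> \<in> C0 \<Omega> \<Longrightarrow> (\<integral>x. \<phi> x \<partial>\<mu> n) = c n * (\<integral>x. \<phi> x \<partial>\<rho> n)"
  shows "vague_conv \<Omega> \<mu> (density P (\<lambda>_. ennreal m))"
  unfolding vague_conv_def
proof
  fix \<phi> assume \<phi>: "\<phi> \<in> C0 \<Omega>"
  have "(\<integral>x. \<phi> x \<partial>density P (\<lambda>_. ennreal m)) = m * (\<integral>x. \<phi> x \<partial>P)"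
    using borel_measurable_integrable[OF integrable_C0[OF assms(2,3,1) \<phi>]] \<open>0 \<le> m\<close>
    by (subst integral_density) auto
  then show "(\<lambda>n. \<integral>x. \<phi> x \<partial>\<mu> n) \<longlonglongrightarrow> (\<integral>x. \<phi> x \<partial>density P (\<lambda>_. ennreal m))"
    using tendsto_mult[OF c(1) bspec[OF conv[unfolded vague_conv_def] \<phi>]]
    by (simp add: scaled[OF \<phi>])
qed

theorem finite_measure_vague_subsequence:
  fixes \<mu> :: "nat \<Rightarrow> 'a::euclidean_space measure"
  assumes "open \<Omega>" and fin: "\<And>n. finite_measure (\<mu> n)" and sets_\<mu>: "\<And>n. sets (\<mu> n) = sets borel"
    and mass: "\<And>n. measure (\<mu> n) UNIV \<le> C"
  obtains r M m where "strict_mono (r :: nat \<Rightarrow> nat)" "finite_measure M" "sets M = sets borel"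
    "emeasure M (- \<Omega>) = 0" "(\<lambda>n. measure (\<mu> (r n)) UNIV) \<longlonglongrightarrow> m" "measure M UNIV \<le> m"
    "vague_conv \<Omega> (\<lambda>n. \<mu> (r n)) M"
proof -
  have space_\<mu>: "space (\<mu> n) = UNIV" for n
    using sets_eq_imp_space_eq[OF sets_\<mu>] by simp
  obtain \<rho> where prob: "\<And>n. prob_space (\<rho> n)" and sets_\<rho>: "\<And>n. sets (\<rho> n) = sets borel"
    and scaled: "\<And>n (\<phi> :: 'a \<Rightarrow> real). \<phi> \<in> borel_measurable borel \<Longrightarrow>
      (\<integral>x. \<phi> x \<partial>\<mu> n) = measure (\<mu> n) UNIV * (\<integral>x. \<phi> x \<partial>\<rho> n)"
    using finite_measure_normalized[OF fin] measurable_cong_sets[OF sets_\<mu> refl]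
    by (metis UNIV_not_empty sets_\<mu> space_\<mu>)
  obtain r1 P where r1: "strict_mono (r1 :: nat \<Rightarrow> nat)"
    and P: "finite_measure P" "sets P = sets borel" "emeasure P (- \<Omega>) = 0" "measure P UNIV \<le> 1"
      "vague_conv \<Omega> (\<lambda>n. \<rho> (r1 n)) P"
    using prob_vague_subsequence[of \<Omega> \<rho>] \<open>open \<Omega>\<close> prob sets_\<rho> by metis
  have "bounded (range (\<lambda>n. measure (\<mu> (r1 n)) UNIV))"
    using mass by (auto simp: bounded_iff intro!: exI[of _ C])
  then obtain m r2 where r2: "strict_mono (r2 :: nat \<Rightarrow> nat)"
    and m: "(\<lambda>n. measure (\<mu> (r1 (r2 n))) UNIV) \<longlonglongrightarrow> m"
    using bounded_imp_convergent_subsequence by (force simp: comp_def)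
  have "0 \<le> m"
    by (rule LIMSEQ_le_const[OF m]) simp
  interpret P: finite_measure P by fact
  let ?M = "density P (\<lambda>_. ennreal m)"
  show thesis
  proof (rule that[OF strict_mono_compose[OF r1 r2]])
    show "finite_measure ?M" "sets ?M = sets borel" "emeasure ?M (- \<Omega>) = 0"
      using P \<open>open \<Omega>\<close> sets_eq_imp_space_eq[OF P(2)]
      by (auto simp: emeasure_density_const ennreal_mult_eq_top_iff intro!: finite_measureI)
    show "measure ?M UNIV \<le> m"
      using P(2,4) \<open>0 \<le> m\<close> by (simp add: measure_density_const mult_left_le)
    show "vague_conv \<Omega> (\<lambda>n. \<mu> (r1 (r2 n))) ?M"
      using vague_conv_scaled[OF \<open>open \<Omega>\<close> P(1,2) vague_conv_subseq[OF P(5) r2] m \<open>0 \<le> m\<close>]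
      by (simp add: scaled borel_measurable_C0[OF \<open>open \<Omega>\<close>])
  qed (rule m)
qed

section \<open>Jordan decomposition\<close>

lemma dominated_finite_measure_density:
  assumes "finite_measure M" "sets N = sets M"
    and le: "\<And>A. A \<in> sets M \<Longrightarrow> emeasure N A \<le> emeasure M A"
  obtains d :: "'a \<Rightarrow> real"
  where "d \<in> borel_measurable M" "\<And>x. 0 \<le> d x" "density M (\<lambda>x. ennreal (d x)) = N"
proof -
  interpret M: finite_measure M by fact
  have "emeasure N (space N) \<le> emeasure M (space M)"
    using le[OF sets.top] by (simp add: sets_eq_imp_space_eq[OF assms(2)])
  then have "finite_measure N"
    by (intro finite_measureI) (use M.emeasure_finite in \<open>auto simp: top_unique\<close>)
  have "emeasure N A = 0" if "A \<in> sets M" "emeasure M A = 0" for A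
    using le[of A] that by simp
  then have ac: "absolutely_continuous M N"
    using assms(2) by (auto simp: absolutely_continuous_def null_sets_def)
  obtain d where d: "d \<in> borel_measurable M" "\<And>x. 0 \<le> d x"
    "AE x in M. RN_deriv M N x = ennreal (d x)"
    using M.real_RN_deriv[OF \<open>finite_measure N\<close> ac assms(2)] by metis
  then have "density M (\<lambda>x. ennreal (d x)) = density M (RN_deriv M N)"
    by (intro density_cong) auto
  also have "\<dots> = N"
    by (rule M.density_RN_deriv[OF ac assms(2)])
  finally show thesis
    using that d(1,2) by blast
qed

lemma integral_diff_measure:
  fixes \<phi> :: "'a \<Rightarrow> real"
  assumes M: "finite_measure M" and N: "finite_measure N" and sets_N: "sets N = sets M"
    and le: "\<And>A. A \<in> sets M \<Longrightarrow> emeasure N A \<le> emeasure M A" and \<phi>: "integrable M \<phi>"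
  shows "(\<integral>x. \<phi> x \<partial>diff_measure M N) = (\<integral>x. \<phi> x \<partial>M) - (\<integral>x. \<phi> x \<partial>N)"
proof -
  note [measurable] = borel_measurable_integrable[OF \<phi>]
  let ?D = "diff_measure M N"
  have D: "emeasure ?D A = emeasure M A - emeasure N A" if "A \<in> sets M" for A
    using that by (intro emeasure_diff_measure M N le) (auto simp: sets_N)
  obtain n where [measurable]: "n \<in> borel_measurable M" and n_nonneg: "\<And>x. 0 \<le> n x"
    and n: "density M (\<lambda>x. ennreal (n x)) = N"
    using dominated_finite_measure_density[OF M sets_N le] by metis
  obtain d where [measurable]: "d \<in> borel_measurable M" and d_nonneg: "\<And>x. 0 \<le> d x"
    and d: "density M (\<lambda>x. ennreal (d x)) = ?D"
    using dominated_finite_measure_density[OF M, of ?D] by (auto simp: D diff_le_self_ennreal)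
  have sum: "density M (\<lambda>x. ennreal (d x + n x)) = M"
  proof (rule measure_eqI)
    fix A assume "A \<in> sets (density M (\<lambda>x. ennreal (d x + n x)))"
    then have A: "A \<in> sets M" by simp
    have "emeasure (density M (\<lambda>x. ennreal (d x + n x))) A =
      emeasure (density M (\<lambda>x. ennreal (d x))) A + emeasure (density M (\<lambda>x. ennreal (n x))) A"
      using A
      by (simp add: emeasure_density ennreal_plus distrib_right nn_integral_add d_nonneg n_nonneg)
    also have "\<dots> = emeasure M A"
      using A le[OF A] by (simp add: d n D diff_add_cancel_ennreal)
    finally show "emeasure (density M (\<lambda>x. ennreal (d x + n x))) A = emeasure M A" .
  qed simp
  have "integrable (density M (\<lambda>x. ennreal (d x + n x))) \<phi>"
    by (simp only: sum \<phi>)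
  then have int_sum: "integrable M (\<lambda>x. (d x + n x) * \<phi> x)"
    by (subst (asm) integrable_density) (simp_all add: d_nonneg n_nonneg)
  have int: "integrable M (\<lambda>x. d x * \<phi> x)" "integrable M (\<lambda>x. n x * \<phi> x)"
    by (rule Bochner_Integration.integrable_bound[OF int_sum];
        simp add: abs_mult mult_right_mono d_nonneg n_nonneg)+
  have density: "(\<integral>x. \<phi> x \<partial>density M (\<lambda>x. ennreal (h x))) = (\<integral>x. h x * \<phi> x \<partial>M)"
    if "h \<in> borel_measurable M" "\<And>x. 0 \<le> h x" for h :: "'a \<Rightarrow> real"
    using that by (subst integral_density) simp_all
  have "(\<integral>x. \<phi> x \<partial>M) = (\<integral>x. (d x + n x) * \<phi> x \<partial>M)"
    using density[of "\<lambda>x. d x + n x"] by (simp only: sum) (simp add: d_nonneg n_nonneg)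
  also have "\<dots> = (\<integral>x. d x * \<phi> x \<partial>M) + (\<integral>x. n x * \<phi> x \<partial>M)"
    by (simp add: distrib_right int)
  also have "\<dots> = (\<integral>x. \<phi> x \<partial>?D) + (\<integral>x. \<phi> x \<partial>N)"
    using density[of d] density[of n] by (simp only: d n) (simp add: d_nonneg n_nonneg)
  finally show ?thesis by simp
qed

lemma integral_restricted:
  fixes \<phi> :: "'a \<Rightarrow> real"
  assumes [measurable]: "Y \<in> sets M" and \<phi>: "integrable M \<phi>"
  shows "integrable (density M (indicator Y)) \<phi>"
    and "(\<integral>x. \<phi> x \<partial>density M (indicator Y)) = (\<integral>x\<in>Y. \<phi> x \<partial>M)"
proof -
  note [measurable] = borel_measurable_integrable[OF \<phi>]
  have indicator: "density M (indicator Y) = density M (\<lambda>x. ennreal (indicator Y x))"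
    by (simp add: ennreal_indicator)
  show "integrable (density M (indicator Y)) \<phi>"
    unfolding indicator using integrable_mult_indicator[OF _ \<phi>, of Y]
    by (simp add: integrable_density del: ennreal_indicator)
  show "(\<integral>x. \<phi> x \<partial>density M (indicator Y)) = (\<integral>x\<in>Y. \<phi> x \<partial>M)"
    unfolding indicator set_lebesgue_integral_def
    by (simp add: integral_density del: ennreal_indicator)
qed

lemma diff_measure_restricted:
  assumes M: "finite_measure M" and N: "finite_measure N" "sets N = sets M" and Y: "Y \<in> sets M"
    and le: "\<And>A. A \<in> sets M \<Longrightarrow> A \<subseteq> Y \<Longrightarrow> emeasure N A \<le> emeasure M A"
  obtains D where "finite_measure D" "sets D = sets M"
    "\<And>A. A \<in> sets M \<Longrightarrow> emeasure D A \<le> emeasure M A" "emeasure D (space M - Y) = 0"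
    "\<And>\<phi> :: 'a \<Rightarrow> real. integrable M \<phi> \<Longrightarrow> integrable N \<phi> \<Longrightarrow>
      (\<integral>x. \<phi> x \<partial>D) = (\<integral>x\<in>Y. \<phi> x \<partial>M) - (\<integral>x\<in>Y. \<phi> x \<partial>N)"
proof -
  let ?M = "density M (indicator Y)" and ?N = "density N (indicator Y)"
  have fin: "finite_measure ?M" "finite_measure ?N"
    using M N Y by (auto intro: finite_measure.finite_measure_restricted)
  have restricted: "emeasure ?M A = emeasure M (Y \<inter> A)" "emeasure ?N A = emeasure N (Y \<inter> A)"
    if "A \<in> sets M" for A
    using that Y N by (simp_all add: emeasure_restricted)
  have restricted_le: "emeasure ?N A \<le> emeasure ?M A" if "A \<in> sets ?M" for A
    using that Y by (simp add: restricted le)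
  let ?D = "diff_measure ?M ?N"
  have D: "emeasure ?D A = emeasure M (Y \<inter> A) - emeasure N (Y \<inter> A)" if "A \<in> sets M" for A
    using that restricted_le fin N(2) by (subst emeasure_diff_measure) (simp_all add: restricted)
  have le_M: "emeasure ?D A \<le> emeasure M A" if "A \<in> sets M" for A
  proof -
    have "emeasure ?D A \<le> emeasure M (Y \<inter> A)"
      by (simp add: D that diff_le_self_ennreal)
    also have "\<dots> \<le> emeasure M A"
      using that by (intro emeasure_mono) auto
    finally show ?thesis .
  qed
  show thesis
  proof
    show "finite_measure ?D"
      using le_M[of "space M"] finite_measure.emeasure_finite[OF M]
      by (intro finite_measureI) (auto simp: top_unique)
    show "emeasure ?D A \<le> emeasure M A" if "A \<in> sets M" for A
      by (rule le_M[OF that])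
    show "emeasure ?D (space M - Y) = 0"
      using Y by (simp add: D Diff_disjoint)
    show "(\<integral>x. \<phi> x \<partial>?D) = (\<integral>x\<in>Y. \<phi> x \<partial>M) - (\<integral>x\<in>Y. \<phi> x \<partial>N)"
      if "integrable M \<phi>" "integrable N \<phi>" for \<phi> :: "'a \<Rightarrow> real"
      using integral_diff_measure[OF fin _ restricted_le] that Y N(2)
      by (simp add: integral_restricted)
  qed simp
qed

lemma integral_eq_set_integral_Compl:
  fixes \<phi> :: "'a \<Rightarrow> real"
  assumes "integrable M \<phi>" "Y \<in> sets M" "- Y \<in> sets M"
  shows "(\<integral>x. \<phi> x \<partial>M) = (\<integral>x\<in>Y. \<phi> x \<partial>M) + (\<integral>x\<in>-Y. \<phi> x \<partial>M)"
proof -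
  have "set_integrable M A \<phi>" if "A \<in> sets M" for A
    unfolding set_integrable_def using that \<open>integrable M \<phi>\<close> by (rule integrable_mult_indicator)
  with assms(2,3) have "(\<integral>x\<in>Y \<union> - Y. \<phi> x \<partial>M) = (\<integral>x\<in>Y. \<phi> x \<partial>M) + (\<integral>x\<in>-Y. \<phi> x \<partial>M)"
    by (intro set_integral_Un) auto
  then show ?thesis
    by (simp add: set_lebesgue_integral_def)
qed

lemma exists_smeasure_sintegral_eq_diff:
  fixes P N :: "'a::euclidean_space measure"
  assumes P: "finite_measure P" "sets P = sets borel"
    and N: "finite_measure N" "sets N = sets borel"
    and null: "emeasure P (- \<Omega>) = 0" "emeasure N (- \<Omega>) = 0" and "open \<Omega>"
  obtains \<nu> where "is_smeasure \<Omega> \<nu>" "tv_norm \<nu> \<le> measure P UNIV + measure N UNIV"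
    "\<And>\<phi>. integrable P \<phi> \<Longrightarrow> integrable N \<phi> \<Longrightarrow> sintegral \<phi> \<nu> = (\<integral>x. \<phi> x \<partial>P) - (\<integral>x. \<phi> x \<partial>N)"
proof -
  have space: "space P = UNIV" "space N = UNIV"
    using sets_eq_imp_space_eq[OF P(2)] sets_eq_imp_space_eq[OF N(2)] by simp_all
  obtain Y where Y: "Y \<in> sets borel"
    and N_le: "\<And>A. A \<in> sets borel \<Longrightarrow> A \<subseteq> Y \<Longrightarrow> emeasure N A \<le> emeasure P A"
    and P_le: "\<And>A. A \<in> sets borel \<Longrightarrow> A \<subseteq> - Y \<Longrightarrow> emeasure P A \<le> emeasure N A"
    using finite_unsigned_Hahn_decomposition[OF P(1) N(1)] P(2) N(2)
    by (metis disjoint_eq_subset_Compl)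
  have Compl_Y: "- Y \<in> sets borel"
    using Y by simp
  obtain U where U: "finite_measure U" "sets U = sets borel" "emeasure U (- Y) = 0"
    and U_le: "\<And>A. A \<in> sets borel \<Longrightarrow> emeasure U A \<le> emeasure P A"
    and int_U: "\<And>\<phi> :: 'a \<Rightarrow> real. integrable P \<phi> \<Longrightarrow> integrable N \<phi> \<Longrightarrow>
      (\<integral>x. \<phi> x \<partial>U) = (\<integral>x\<in>Y. \<phi> x \<partial>P) - (\<integral>x\<in>Y. \<phi> x \<partial>N)"
    using diff_measure_restricted[OF P(1) N(1),
        unfolded P(2) N(2) space Compl_eq_Diff_UNIV[symmetric], OF refl Y N_le] by metis
  obtain V where V: "finite_measure V" "sets V = sets borel" "emeasure V Y = 0"
    and V_le: "\<And>A. A \<in> sets borel \<Longrightarrow> emeasure V A \<le> emeasure N A"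
    and int_V: "\<And>\<phi> :: 'a \<Rightarrow> real. integrable N \<phi> \<Longrightarrow> integrable P \<phi> \<Longrightarrow>
      (\<integral>x. \<phi> x \<partial>V) = (\<integral>x\<in>-Y. \<phi> x \<partial>N) - (\<integral>x\<in>-Y. \<phi> x \<partial>P)"
    using diff_measure_restricted[OF N(1) P(1),
        unfolded P(2) N(2) space Compl_eq_Diff_UNIV[symmetric], OF refl Compl_Y P_le]
    by (metis double_complement)
  show thesis
  proof
    have "- \<Omega> \<in> sets borel"
      using \<open>open \<Omega>\<close> by auto
    then show "is_smeasure \<Omega> (U, V)"
      using U V null U_le[of "- \<Omega>"] V_le[of "- \<Omega>"] Y by (auto simp: is_smeasure_def)
    show "tv_norm (U, V) \<le> measure P UNIV + measure N UNIV"
      using U_le[of UNIV] V_le[of UNIV] P(1) N(1) U(1) V(1)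
      by (simp add: tv_norm_def add_mono finite_measure.emeasure_eq_measure)
    show "sintegral \<phi> (U, V) = (\<integral>x. \<phi> x \<partial>P) - (\<integral>x. \<phi> x \<partial>N)"
      if "integrable P \<phi>" "integrable N \<phi>" for \<phi>
      using that Y
      by (simp add: sintegral_def int_U int_V integral_eq_set_integral_Compl[of _ _ Y] P N)
  qed
qed

text \<open>The limits of the two Jordan parts need not be mutually singular, hence the new
  decomposition.\<close>

lemma weakstar_conv_if_parts_vague_conv:
  fixes \<mu> :: "nat \<Rightarrow> 'a::euclidean_space smeasure"
  assumes "open \<Omega>"
    and P: "finite_measure P" "sets P = sets borel" "emeasure P (- \<Omega>) = 0"
      "vague_conv \<Omega> (\<lambda>n. fst (\<mu> n)) P"
    and N: "finite_measure N" "sets N = sets borel" "emeasure N (- \<Omega>) = 0"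
      "vague_conv \<Omega> (\<lambda>n. snd (\<mu> n)) N"
  obtains \<nu> where "is_smeasure \<Omega> \<nu>" "tv_norm \<nu> \<le> measure P UNIV + measure N UNIV"
    "weakstar_conv \<Omega> \<mu> \<nu>"
proof -
  obtain \<nu> where \<nu>: "is_smeasure \<Omega> \<nu>" "tv_norm \<nu> \<le> measure P UNIV + measure N UNIV"
    "\<And>\<phi>. integrable P \<phi> \<Longrightarrow> integrable N \<phi> \<Longrightarrow> sintegral \<phi> \<nu> = (\<integral>x. \<phi> x \<partial>P) - (\<integral>x. \<phi> x \<partial>N)"
    using exists_smeasure_sintegral_eq_diff[OF P(1,2) N(1,2) P(3) N(3) \<open>open \<Omega>\<close>] by metis
  have "weakstar_conv \<Omega> \<mu> \<nu>"
    unfolding weakstar_conv_def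
  proof
    fix \<phi> assume \<phi>: "\<phi> \<in> C0 \<Omega>"
    have "sintegral \<phi> \<nu> = (\<integral>x. \<phi> x \<partial>P) - (\<integral>x. \<phi> x \<partial>N)"
      using P N \<open>open \<Omega>\<close> \<phi> by (intro \<nu>(3) integrable_C0)
    then show "(\<lambda>n. sintegral \<phi> (\<mu> n)) \<longlonglongrightarrow> sintegral \<phi> \<nu>"
      using P(4) N(4) \<phi> by (simp add: sintegral_def vague_conv_def tendsto_diff)
  qed
  with \<nu>(1,2) show thesis by (rule that)
qed

theorem smeasure_weakstar_subsequence:
  fixes \<mu> :: "nat \<Rightarrow> 'a::euclidean_space smeasure"
  assumes "open \<Omega>" and \<mu>: "\<And>n. is_smeasure \<Omega> (\<mu> n)" and bounded: "\<And>n. tv_norm (\<mu> n) \<le> C"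
  obtains r \<nu> m where "strict_mono (r :: nat \<Rightarrow> nat)" "is_smeasure \<Omega> \<nu>"
    "weakstar_conv \<Omega> (\<lambda>n. \<mu> (r n)) \<nu>" "(\<lambda>n. tv_norm (\<mu> (r n))) \<longlonglongrightarrow> m" "tv_norm \<nu> \<le> m"
proof -
  have parts: "finite_measure (fst (\<mu> n))" "sets (fst (\<mu> n)) = sets borel"
    "finite_measure (snd (\<mu> n))" "sets (snd (\<mu> n)) = sets borel" for n
    using \<mu>[of n] by (auto simp: is_smeasure_def)
  have masses: "measure (fst (\<mu> n)) UNIV \<le> C" "measure (snd (\<mu> n)) UNIV \<le> C" for n
    using bounded[of n] measure_nonneg[of "fst (\<mu> n)" UNIV] measure_nonneg[of "snd (\<mu> n)" UNIV]
    unfolding tv_norm_def by linarith+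
  obtain r1 P p where r1: "strict_mono (r1 :: nat \<Rightarrow> nat)"
    and P: "finite_measure P" "sets P = sets borel" "emeasure P (- \<Omega>) = 0"
    and p: "(\<lambda>n. measure (fst (\<mu> (r1 n))) UNIV) \<longlonglongrightarrow> p" "measure P UNIV \<le> p"
    and P_lim: "vague_conv \<Omega> (\<lambda>n. fst (\<mu> (r1 n))) P"
    using finite_measure_vague_subsequence[of \<Omega> "\<lambda>n. fst (\<mu> n)" C]
      \<open>open \<Omega>\<close> parts masses by metis
  obtain r2 N n where r2: "strict_mono (r2 :: nat \<Rightarrow> nat)"
    and N: "finite_measure N" "sets N = sets borel" "emeasure N (- \<Omega>) = 0"
    and n: "(\<lambda>n. measure (snd (\<mu> (r1 (r2 n)))) UNIV) \<longlonglongrightarrow> n" "measure N UNIV \<le> n"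
    and N_lim: "vague_conv \<Omega> (\<lambda>n. snd (\<mu> (r1 (r2 n)))) N"
    using finite_measure_vague_subsequence[of \<Omega> "\<lambda>n. snd (\<mu> (r1 n))" C]
      \<open>open \<Omega>\<close> parts masses by metis
  have "(\<lambda>n. measure (fst (\<mu> (r1 (r2 n)))) UNIV) \<longlonglongrightarrow> p"
    using LIMSEQ_subseq_LIMSEQ[OF p(1) r2] by (simp add: comp_def)
  from tendsto_add[OF this n(1)] have tv: "(\<lambda>n. tv_norm (\<mu> (r1 (r2 n)))) \<longlonglongrightarrow> p + n"
    by (simp add: tv_norm_def)
  obtain \<nu> where \<nu>: "is_smeasure \<Omega> \<nu>" "tv_norm \<nu> \<le> measure P UNIV + measure N UNIV"
    "weakstar_conv \<Omega> (\<lambda>n. \<mu> (r1 (r2 n))) \<nu>"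
    by (rule weakstar_conv_if_parts_vague_conv[OF \<open>open \<Omega>\<close> P
          vague_conv_subseq[OF P_lim r2] N N_lim])
  then have "tv_norm \<nu> \<le> p + n"
    using p(2) n(2) by linarith
  then show thesis
    by (rule that[OF strict_mono_compose[OF r1 r2] \<nu>(1,3) tv])
qed

section \<open>Lower semicontinuity and conjugates\<close>

lemma lsc_ext_tendsto_le:
  assumes "lsc_ext f" and y: "(y \<longlongrightarrow> y0) F" and b: "(b \<longlongrightarrow> B) F" and "F \<noteq> bot"
    and le: "\<And>n. f (y n) \<le> b n"
  shows "f y0 \<le> B"
proof (rule ccontr)
  assume "\<not> f y0 \<le> B"
  then obtain c where "B < c" "c < f y0"
    using dense[of B "f y0"] by (auto simp: not_le)
  then have "\<forall>\<^sub>F z in nhds y0. c < f z"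
    using \<open>lsc_ext f\<close> by (simp add: lsc_ext_def)
  then have "\<forall>\<^sub>F n in F. c < f (y n)"
    using y by (rule eventually_compose_filterlim)
  moreover have "\<forall>\<^sub>F n in F. b n < c"
    using b \<open>B < c\<close> by (rule order_tendstoD)
  ultimately have "\<forall>\<^sub>F n in F. False"
  proof eventually_elim
    case (elim n)
    then show ?case
      using le[of n] by simp
  qed
  then show False
    using \<open>F \<noteq> bot\<close> by (simp add: trivial_limit_def)
qed

lemma conj_fun_upper: "ereal (q \<bullet> y) - f y \<le> conj_fun f q"
  unfolding conj_fun_def by (rule SUP_upper) simp

lemma conj_fun_not_MInf:
  assumes "proper_fun f"
  shows "conj_fun f q \<noteq> - \<infinity>"
proof -
  obtain y where "f y \<noteq> \<infinity>"
    using assms by (auto simp: proper_fun_def)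
  then show ?thesis
    using conj_fun_upper[of q y f] by (cases "f y") auto
qed

lemma lsc_ext_conj_fun: "lsc_ext (conj_fun f)"
  unfolding lsc_ext_def
proof (intro allI impI)
  fix q c assume "c < conj_fun f q"
  then obtain y where y: "c < ereal (q \<bullet> y) - f y"
    by (auto simp: conj_fun_def less_SUP_iff)
  have "((\<lambda>z. ereal (z \<bullet> y) - f y) \<longlongrightarrow> ereal (q \<bullet> y) - f y) (nhds q)"
  proof (cases "f y")
    case (real b)
    have "((\<lambda>z. ereal (z \<bullet> y - b)) \<longlongrightarrow> ereal (q \<bullet> y - b)) (nhds q)"
      by (intro tendsto_intros) (rule filterlim_ident)
    then show ?thesis by (simp add: real)
  qed simp_all
  from order_tendstoD(1)[OF this y] show "\<forall>\<^sub>F z in nhds q. c < conj_fun f z"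
    by eventually_elim (rule less_le_trans[OF _ conj_fun_upper])
qed

lemma conj_fun_coercive:
  assumes "\<And>y. norm y \<le> 1 \<Longrightarrow> f y \<le> ereal B"
  shows "ereal (norm q - B) \<le> conj_fun f q"
proof -
  have "q \<bullet> sgn q = norm q"
    by (cases "q = 0") (simp_all add: sgn_div_norm dot_square_norm power2_eq_square)
  moreover have "f (sgn q) \<le> ereal B"
    by (rule assms) (simp add: norm_sgn)
  ultimately have "ereal (norm q - B) \<le> ereal (q \<bullet> sgn q) - f (sgn q)"
    by (cases "f (sgn q)") auto
  also have "\<dots> \<le> conj_fun f q"
    by (rule conj_fun_upper)
  finally show ?thesis .
qed

section \<open>The operator and its adjoint\<close>

lemma opAadj_C0: "(\<And>i. a i \<in> C0 \<Omega>) \<Longrightarrow> opAadj a q \<in> C0 \<Omega>"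
  unfolding opAadj_def by (intro C0_sum C0_mult_left)

lemma opAadj_diff: "opAadj a (p - q) x = opAadj a p x - opAadj a q x"
  by (simp add: opAadj_def left_diff_distrib sum_subtractf)

lemma tendsto_opAadj:
  assumes "(q \<longlongrightarrow> p) F"
  shows "((\<lambda>n. opAadj a (q n) x) \<longlongrightarrow> opAadj a p x) F"
  unfolding opAadj_def by (intro tendsto_intros assms)

lemma opAadj_bounded:
  assumes "\<And>i. a i \<in> C0 \<Omega>"
  obtains C where "\<And>q x. \<bar>opAadj a q x\<bar> \<le> C * norm q"
proof -
  obtain B where B: "\<And>i x. \<bar>a i x\<bar> \<le> B i"
    using C0_bounded[OF assms] by metis
  have "\<bar>opAadj a q x\<bar> \<le> (\<Sum>i\<in>UNIV. B i) * norm q" for q x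
  proof -
    have "\<bar>opAadj a q x\<bar> \<le> (\<Sum>i\<in>UNIV. \<bar>q $ i * a i x\<bar>)"
      unfolding opAadj_def by (rule sum_abs)
    also have "\<dots> \<le> (\<Sum>i\<in>UNIV. norm q * B i)"
      unfolding abs_mult by (intro sum_mono mult_mono component_le_norm_cart B) auto
    finally show ?thesis
      by (simp add: sum_distrib_left mult.commute)
  qed
  then show thesis by (rule that)
qed

lemma inner_opA:
  assumes "open \<Omega>" "is_smeasure \<Omega> \<nu>" "\<And>i. a i \<in> C0 \<Omega>"
  shows "q \<bullet> opA a \<nu> = sintegral (opAadj a q) \<nu>"
proof -
  have "integrable (fst \<nu>) (a i)" "integrable (snd \<nu>) (a i)" for i
    using assms by (auto simp: is_smeasure_def intro!: integrable_C0)
  then show ?thesis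
    by (simp add: opA_def opAadj_def sintegral_def inner_vec_def sum_subtractf right_diff_distrib)
qed

lemma tendsto_opA:
  assumes "weakstar_conv \<Omega> \<mu> \<nu>" "\<And>i. a i \<in> C0 \<Omega>"
  shows "(\<lambda>n. opA a (\<mu> n)) \<longlonglongrightarrow> opA a \<nu>"
  using assms unfolding weakstar_conv_def opA_def by (intro vec_tendstoI) simp

lemma abs_integral_le_measure:
  fixes \<phi> :: "'a \<Rightarrow> real"
  assumes "finite_measure M" "integrable M \<phi>" "AE x in M. \<bar>\<phi> x\<bar> \<le> 1"
  shows "\<bar>\<integral>x. \<phi> x \<partial>M\<bar> \<le> measure M (space M)"
proof -
  interpret finite_measure M by fact
  have "\<bar>\<integral>x. \<phi> x \<partial>M\<bar> \<le> (\<integral>x. \<bar>\<phi> x\<bar> \<partial>M)"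
    using integral_norm_bound[of M \<phi>] by simp
  also have "\<dots> \<le> (\<integral>x. 1 \<partial>M)"
    using assms(2,3) by (intro integral_mono_AE) auto
  finally show ?thesis by simp
qed

lemma abs_sintegral_le_tv_norm:
  assumes "open \<Omega>" "\<nu> \<in> Meas \<Omega> \<Omega>'" "\<phi> \<in> C0 \<Omega>" and le: "\<And>x. x \<in> \<Omega>' \<Longrightarrow> \<bar>\<phi> x\<bar> \<le> 1"
  shows "\<bar>sintegral \<phi> \<nu>\<bar> \<le> tv_norm \<nu>"
proof -
  have \<nu>: "is_smeasure \<Omega> \<nu>" "supported_in \<Omega>' \<nu>"
    using assms(2) by (auto simp: Meas_def)
  then obtain N where N: "N \<in> sets borel" "- \<Omega>' \<subseteq> N"
    "emeasure (fst \<nu>) N = 0" "emeasure (snd \<nu>) N = 0"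
    by (auto simp: supported_in_def)
  have "\<bar>\<integral>x. \<phi> x \<partial>M\<bar> \<le> measure M UNIV"
    if M: "finite_measure M" "sets M = sets borel" "emeasure M N = 0" for M
  proof -
    have "{x. \<not> \<bar>\<phi> x\<bar> \<le> 1} \<subseteq> N"
      using N(2) le by blast
    then have "AE x in M. \<bar>\<phi> x\<bar> \<le> 1"
      using N(1) M by (intro AE_I'[of N]) (auto simp: null_sets_def)
    then show ?thesis
      using abs_integral_le_measure[OF M(1) integrable_C0[OF M(1,2) assms(1,3)]]
        sets_eq_imp_space_eq[OF M(2)] by simp
  qed
  then have "\<bar>\<integral>x. \<phi> x \<partial>fst \<nu>\<bar> \<le> measure (fst \<nu>) UNIV" "\<bar>\<integral>x. \<phi> x \<partial>snd \<nu>\<bar> \<le> measure (snd \<nu>) UNIV"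
    using \<nu>(1) N by (auto simp: is_smeasure_def)
  then show ?thesis
    unfolding sintegral_def tv_norm_def by linarith
qed

lemma abs_inner_opA_le_tv_norm:
  assumes "open \<Omega>" "\<And>i. a i \<in> C0 \<Omega>" "\<nu> \<in> Meas \<Omega> \<Omega>'" "q \<in> feas_D a \<Omega>'"
  shows "\<bar>q \<bullet> opA a \<nu>\<bar> \<le> tv_norm \<nu>"
proof -
  have "q \<bullet> opA a \<nu> = sintegral (opAadj a q) \<nu>"
    using assms by (intro inner_opA) (auto simp: Meas_def)
  then show ?thesis
    using abs_sintegral_le_tv_norm[OF assms(1,3) opAadj_C0[of a, OF assms(2)]] assms(4)
    by (simp add: feas_D_def)
qed

lemma exch_X_contains_maximizer:
  assumes "\<And>i. a i \<in> C0 \<Omega>" and violated: "\<bar>opAadj a q x\<bar> > 1"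
  obtains y where "y \<in> exch_X \<Omega> a q" "\<And>z. \<bar>opAadj a q z\<bar> \<le> \<bar>opAadj a q y\<bar>"
proof -
  have "opAadj a q x \<noteq> 0"
    using violated by auto
  then obtain y where "y \<in> \<Omega>" and y: "\<And>z. \<bar>opAadj a q z\<bar> \<le> \<bar>opAadj a q y\<bar>"
    using C0_abs_attains_max[OF opAadj_C0[of a \<Omega> q, OF assms(1)], of x] by blast
  have "1 < \<bar>opAadj a q y\<bar>"
    using violated y[of x] by linarith
  then have "y \<in> exch_X \<Omega> a q"
    using \<open>y \<in> \<Omega>\<close> y by (auto simp: exch_X_def local_max_in_def intro!: exI[of _ 1])
  then show thesis
    using y by (rule that)
qed

section \<open>Optimal values\<close>

lemma tv_norm_nonneg: "0 \<le> tv_norm \<nu>"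
  by (simp add: tv_norm_def)

lemma Meas_mono: "\<Omega>' \<subseteq> \<Omega>'' \<Longrightarrow> Meas \<Omega> \<Omega>' \<subseteq> Meas \<Omega> \<Omega>''"
  unfolding Meas_def supported_in_def by blast

lemma is_smeasure_imp_Meas:
  assumes "open \<Omega>" "is_smeasure \<Omega> \<nu>"
  shows "\<nu> \<in> Meas \<Omega> \<Omega>"
proof -
  have "- \<Omega> \<in> sets borel"
    using \<open>open \<Omega>\<close> by auto
  then have "supported_in \<Omega> \<nu>"
    using \<open>is_smeasure \<Omega> \<nu>\<close> unfolding supported_in_def is_smeasure_def by blast
  then show ?thesis
    using \<open>is_smeasure \<Omega> \<nu>\<close> by (simp add: Meas_def)
qed

lemma solves_P_iff: "solves_P \<Omega> a f \<Omega>' \<nu> \<longleftrightarrow> \<nu> \<in> Meas \<Omega> \<Omega>' \<and> Jfun a f \<nu> = val_P \<Omega> a f \<Omega>'"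
proof
  assume "solves_P \<Omega> a f \<Omega>' \<nu>"
  then show "\<nu> \<in> Meas \<Omega> \<Omega>' \<and> Jfun a f \<nu> = val_P \<Omega> a f \<Omega>'"
    unfolding solves_P_def val_P_def by (auto intro!: antisym INF_greatest INF_lower)
qed (auto simp: solves_P_def val_P_def intro: INF_lower)

lemma solves_D_iff: "solves_D a f \<Omega>' q \<longleftrightarrow> q \<in> feas_D a \<Omega>' \<and> - conj_fun f q = val_D a f \<Omega>'"
proof
  assume "solves_D a f \<Omega>' q"
  then show "q \<in> feas_D a \<Omega>' \<and> - conj_fun f q = val_D a f \<Omega>'"
    unfolding solves_D_def val_D_def
    by (auto simp del: ereal_minus_le_minus intro!: antisym SUP_upper SUP_least)
qed (auto simp: solves_D_def val_D_def simp del: ereal_minus_le_minus intro: SUP_upper)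

section \<open>The exchange algorithm\<close>

lemma LIMSEQ_if_subseq_LIMSEQ:
  fixes X :: "nat \<Rightarrow> 'b::topological_space"
  assumes "\<And>s. strict_mono (s :: nat \<Rightarrow> nat) \<Longrightarrow>
    \<exists>r. strict_mono (r :: nat \<Rightarrow> nat) \<and> (\<lambda>n. X (s (r n))) \<longlonglongrightarrow> l"
  shows "X \<longlonglongrightarrow> l"
proof (rule topological_tendstoI, rule ccontr)
  fix U assume "open U" "l \<in> U" and "\<not> (\<forall>\<^sub>F n in sequentially. X n \<in> U)"
  then obtain s :: "nat \<Rightarrow> nat" where "strict_mono s" and outside: "\<And>n. X (s n) \<notin> U"
    using not_eventually_sequentiallyD by blast
  obtain r :: "nat \<Rightarrow> nat" where "(\<lambda>n. X (s (r n))) \<longlonglongrightarrow> l"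
    using assms[OF \<open>strict_mono s\<close>] by blast
  from topological_tendstoD[OF this \<open>open U\<close> \<open>l \<in> U\<close>] show False
    by (simp add: outside)
qed

locale exchange_algorithm =
  fixes \<Omega> :: "'a::euclidean_space set"
    and a :: "'m::finite \<Rightarrow> 'a \<Rightarrow> real"
    and f :: "real^'m \<Rightarrow> ereal"
    and c :: real
    and Om :: "nat \<Rightarrow> 'a set"
    and \<mu> :: "nat \<Rightarrow> 'a smeasure"
    and q :: "nat \<Rightarrow> real^'m"
  assumes \<Omega>_open: "open \<Omega>"
    and a_C0: "\<And>i. a i \<in> C0 \<Omega>"
    and f_proper: "proper_fun f" and f_lsc: "lsc_ext f" and f_ge: "\<And>y. ereal c \<le> f y"
    and Om_Suc: "\<And>k. Om (Suc k) = Om k \<union> exch_X \<Omega> a (q k)"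
    and \<mu>_sol: "\<And>k. solves_P \<Omega> a f (Om k) (\<mu> k)"
    and q_sol: "\<And>k. solves_D a f (Om k) (q k)"
    and standing_\<Omega>: "standing \<Omega> a f \<Omega>"
    and standing_Om: "\<And>k. standing \<Omega> a f (Om k)"
begin

lemma Om_mono: "j \<le> k \<Longrightarrow> Om j \<subseteq> Om k"
  by (rule lift_Suc_mono_le[of Om]) (auto simp: Om_Suc)

lemma is_smeasure_\<mu>: "is_smeasure \<Omega> (\<mu> k)"
  using \<mu>_sol[of k] by (simp add: solves_P_def Meas_def)

lemma q_feasible: "q k \<in> feas_D a (Om k)"
  using q_sol by (simp add: solves_D_def)

lemma conj_fun_q: "conj_fun f (q k) = - Jfun a f (\<mu> k)"
  using \<mu>_sol[of k] q_sol[of k] standing_Om[of k]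
  by (simp add: solves_P_iff solves_D_iff standing_def ereal_uminus_eq_reorder)

lemma Jfun_ge: "ereal (tv_norm \<nu> + c) \<le> Jfun a f \<nu>"
  unfolding Jfun_def using add_left_mono[OF f_ge] by (metis plus_ereal.simps(1))

lemma decseq_Jfun: "decseq (\<lambda>k. Jfun a f (\<mu> k))"
proof (rule decseq_SucI)
  fix k
  have "\<mu> k \<in> Meas \<Omega> (Om (Suc k))"
    using \<mu>_sol[of k] Meas_mono[OF Om_mono[of k "Suc k"]] by (auto simp: solves_P_def)
  then show "Jfun a f (\<mu> (Suc k)) \<le> Jfun a f (\<mu> k)"
    using \<mu>_sol[of "Suc k"] by (simp add: solves_P_def)
qed

lemma val_P_le_Jfun: "is_smeasure \<Omega> \<nu> \<Longrightarrow> val_P \<Omega> a f \<Omega> \<le> Jfun a f \<nu>"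
  unfolding val_P_def by (intro INF_lower is_smeasure_imp_Meas \<Omega>_open)

lemma tv_norm_\<mu>_bounded:
  obtains C where "\<And>k. tv_norm (\<mu> k) \<le> C"
proof -
  have "Jfun a f (\<mu> 0) \<noteq> \<infinity>"
    using conj_fun_not_MInf[OF f_proper, of "q 0"] by (auto simp: conj_fun_q)
  moreover have "Jfun a f (\<mu> 0) \<noteq> - \<infinity>"
    using Jfun_ge[of "\<mu> 0"] by auto
  ultimately obtain b where b: "Jfun a f (\<mu> 0) = ereal b"
    by (cases "Jfun a f (\<mu> 0)") auto
  have "ereal (tv_norm (\<mu> k) + c) \<le> ereal b" for k
    using Jfun_ge[of "\<mu> k"] decseqD[OF decseq_Jfun, of 0 k] unfolding b by (rule order_trans) simp
  then have "tv_norm (\<mu> k) \<le> b - c" for k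
    by (simp add: le_diff_eq)
  then show thesis by (rule that)
qed

lemma conj_fun_q_le: "conj_fun f (q k) \<le> ereal (- c)"
proof -
  have "ereal c \<le> ereal (tv_norm (\<mu> k) + c)"
    by (simp add: tv_norm_nonneg)
  also note Jfun_ge
  finally show ?thesis
    by (simp add: conj_fun_q ereal_uminus_le_reorder)
qed

lemma bounded_range_q_if_continuous:
  assumes finite: "\<And>y. f y \<noteq> \<infinity>" and cont: "continuous_on (cball 0 1) (\<lambda>y. real_of_ereal (f y))"
  shows "bounded (range q)"
proof -
  obtain z where z: "\<And>y. norm y \<le> 1 \<Longrightarrow> real_of_ereal (f y) \<le> real_of_ereal (f z)"
    using continuous_attains_sup[OF compact_cball _ cont] by (auto simp: Ball_def)
  have "f y \<le> ereal (real_of_ereal (f z))" if "norm y \<le> 1" for y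
    using z[OF that] finite[of y] by (cases "f y") auto
  then have "ereal (norm (q k) - real_of_ereal (f z)) \<le> ereal (- c)" for k
    using order_trans[OF conj_fun_coercive conj_fun_q_le] by metis
  then have "norm (q k) \<le> real_of_ereal (f z) - c" for k
    by (simp add: algebra_simps)
  then show ?thesis
    by (auto simp: bounded_iff)
qed

lemma bounded_range_q_if_opA_surj:
  assumes "\<And>y. \<exists>\<nu>\<in>Meas \<Omega> (Om 0). opA a \<nu> = y"
  shows "bounded (range q)"
proof -
  have "\<forall>i. \<exists>\<nu>. \<nu> \<in> Meas \<Omega> (Om 0) \<and> opA a \<nu> = axis i 1"
    using assms by blast
  then obtain \<nu> where \<nu>: "\<And>i. \<nu> i \<in> Meas \<Omega> (Om 0)" "\<And>i. opA a (\<nu> i) = axis i 1"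
    by metis
  have feasible: "q k \<in> feas_D a (Om 0)" for k
    using q_feasible[of k] Om_mono[of 0 k] by (auto simp: feas_D_def)
  have "norm (q k) \<le> (\<Sum>i\<in>UNIV. tv_norm (\<nu> i))" for k
  proof -
    have "norm (q k) \<le> (\<Sum>i\<in>UNIV. \<bar>q k $ i\<bar>)"
      by (rule norm_le_l1_cart)
    also have "\<dots> = (\<Sum>i\<in>UNIV. \<bar>q k \<bullet> opA a (\<nu> i)\<bar>)"
      by (simp add: \<nu>(2) inner_axis)
    also have "\<dots> \<le> (\<Sum>i\<in>UNIV. tv_norm (\<nu> i))"
      by (intro sum_mono abs_inner_opA_le_tv_norm[OF \<Omega>_open a_C0 \<nu>(1) feasible])
    finally show ?thesis .
  qed
  then show ?thesis
    by (auto simp: bounded_iff)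
qed

text \<open>The maximizer of \<open>\<bar>A\<^sup>*q\<^sub>k\<bar>\<close> is a constraint point for every later \<open>q\<^sub>l\<close>, so the infeasibility
  of \<open>q\<^sub>k\<close> is controlled by the distance to any later iterate.\<close>

lemma abs_opAadj_q_le:
  assumes C: "\<And>p x. \<bar>opAadj a p x\<bar> \<le> C * norm p" and "k < l"
  shows "\<bar>opAadj a (q k) x\<bar> \<le> 1 + C * norm (q k - q l)"
proof (cases "\<bar>opAadj a (q k) x\<bar> > 1")
  case True
  then obtain y where y: "y \<in> exch_X \<Omega> a (q k)" "\<And>z. \<bar>opAadj a (q k) z\<bar> \<le> \<bar>opAadj a (q k) y\<bar>"
    using exch_X_contains_maximizer[of a \<Omega> "q k" x, OF a_C0 True] by blast
  have "y \<in> Om l"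
    using y(1) Om_mono[of "Suc k" l] \<open>k < l\<close> by (auto simp: Om_Suc)
  then have "\<bar>opAadj a (q l) y\<bar> \<le> 1"
    using q_feasible[of l] by (simp add: feas_D_def)
  then show ?thesis
    using y(2)[of x] C[of "q k - q l" y] by (simp add: opAadj_diff)
next
  case False
  then show ?thesis
    using C[of "q k - q l" x] by linarith
qed

lemma dual_cluster_point_feasible:
  assumes t: "strict_mono t" and lim: "(\<lambda>n. q (t n)) \<longlonglongrightarrow> p"
  shows "p \<in> feas_D a \<Omega>"
  unfolding feas_D_def
proof (intro CollectI ballI)
  fix x
  obtain C where C: "\<And>p x. \<bar>opAadj a p x\<bar> \<le> C * norm p"
    using opAadj_bounded[of a, OF a_C0] by metis
  have "(\<lambda>n. 1 + C * norm (q (t n) - q (t (Suc n)))) \<longlonglongrightarrow> 1 + C * norm (p - p)"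
    by (intro tendsto_intros lim LIMSEQ_Suc[OF lim])
  moreover have "(\<lambda>n. \<bar>opAadj a (q (t n)) x\<bar>) \<longlonglongrightarrow> \<bar>opAadj a p x\<bar>"
    by (intro tendsto_intros tendsto_opAadj lim)
  moreover have "\<bar>opAadj a (q (t n)) x\<bar> \<le> 1 + C * norm (q (t n) - q (t (Suc n)))" for n
    using t by (intro abs_opAadj_q_le[OF C]) (simp add: strict_mono_Suc_iff)
  ultimately have "\<bar>opAadj a p x\<bar> \<le> 1 + C * norm (p - p)"
    by (intro LIMSEQ_le) auto
  then show "\<bar>opAadj a p x\<bar> \<le> 1" by simp
qed

lemma dual_cluster_point:
  assumes t: "strict_mono t" and lim: "(\<lambda>n. q (t n)) \<longlonglongrightarrow> p"
  shows "solves_D a f \<Omega> p" and "(\<lambda>k. Jfun a f (\<mu> k)) \<longlonglongrightarrow> val_P \<Omega> a f \<Omega>"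
proof -
  define V where "V = (INF k. Jfun a f (\<mu> k))"
  have V: "(\<lambda>k. Jfun a f (\<mu> k)) \<longlonglongrightarrow> V"
    unfolding V_def by (rule LIMSEQ_INF[OF decseq_Jfun])
  have feasible: "p \<in> feas_D a \<Omega>"
    by (rule dual_cluster_point_feasible[OF t lim])
  have "(\<lambda>n. - Jfun a f (\<mu> (t n))) \<longlonglongrightarrow> - V"
    using LIMSEQ_subseq_LIMSEQ[OF V t] by (simp add: comp_def)
  then have "conj_fun f p \<le> - V"
    by (rule lsc_ext_tendsto_le[OF lsc_ext_conj_fun lim]) (simp_all add: conj_fun_q)
  then have "V \<le> - conj_fun f p"
    by (metis ereal_minus_le_minus ereal_uminus_uminus)
  moreover have "- conj_fun f p \<le> val_D a f \<Omega>"
    unfolding val_D_def by (rule SUP_upper[OF feasible])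
  moreover have "val_D a f \<Omega> = val_P \<Omega> a f \<Omega>"
    using standing_\<Omega> by (simp add: standing_def)
  moreover have "val_P \<Omega> a f \<Omega> \<le> V"
    unfolding V_def by (intro INF_greatest val_P_le_Jfun is_smeasure_\<mu>)
  ultimately have "V = val_P \<Omega> a f \<Omega>" "- conj_fun f p = val_D a f \<Omega>"
    by auto
  then show "solves_D a f \<Omega> p" "(\<lambda>k. Jfun a f (\<mu> k)) \<longlonglongrightarrow> val_P \<Omega> a f \<Omega>"
    using V feasible by (simp_all add: solves_D_iff)
qed

lemma primal_cluster_point:
  assumes "is_smeasure \<Omega> \<nu>" and t: "weakstar_conv \<Omega> (\<lambda>n. \<mu> (t n)) \<nu>"
    and m: "(\<lambda>n. tv_norm (\<mu> (t n))) \<longlonglongrightarrow> m" "tv_norm \<nu> \<le> m"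
    and Jfun_lim: "(\<lambda>n. Jfun a f (\<mu> (t n))) \<longlonglongrightarrow> val_P \<Omega> a f \<Omega>"
  shows "solves_P \<Omega> a f \<Omega> \<nu>"
proof -
  let ?V = "val_P \<Omega> a f \<Omega>"
  have opA_lim: "(\<lambda>n. opA a (\<mu> (t n))) \<longlonglongrightarrow> opA a \<nu>"
    by (rule tendsto_opA[OF t a_C0])
  have f_lim: "(\<lambda>n. Jfun a f (\<mu> (t n)) + ereal (- tv_norm (\<mu> (t n)))) \<longlonglongrightarrow> ?V + ereal (- m)"
    using m(1) by (intro tendsto_add_ereal_general1 Jfun_lim tendsto_intros) auto
  have "f (opA a (\<mu> (t n))) \<le> Jfun a f (\<mu> (t n)) + ereal (- tv_norm (\<mu> (t n)))" for n
    by (cases "f (opA a (\<mu> (t n)))") (auto simp: Jfun_def)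
  then have "f (opA a \<nu>) \<le> ?V + ereal (- m)"
    by (rule lsc_ext_tendsto_le[OF f_lsc opA_lim f_lim sequentially_bot])
  then have "Jfun a f \<nu> \<le> ereal m + (?V + ereal (- m))"
    unfolding Jfun_def using m(2) by (intro add_mono) auto
  also have "\<dots> = ?V"
    by (cases ?V) auto
  finally have "Jfun a f \<nu> = ?V"
    using val_P_le_Jfun[OF assms(1)] by (rule antisym)
  then show ?thesis
    by (simp add: solves_P_iff is_smeasure_imp_Meas \<Omega>_open assms(1))
qed

theorem subsequence_converges_to_solutions:
  assumes "bounded (range q)" and s: "strict_mono s"
  obtains r \<nu> p where "strict_mono (r :: nat \<Rightarrow> nat)"
    "weakstar_conv \<Omega> (\<lambda>n. \<mu> (s (r n))) \<nu>" "(\<lambda>n. q (s (r n))) \<longlonglongrightarrow> p"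
    "solves_P \<Omega> a f \<Omega> \<nu>" "solves_D a f \<Omega> p"
    "(\<lambda>n. Jfun a f (\<mu> (s (r n)))) \<longlonglongrightarrow> val_P \<Omega> a f \<Omega>"
proof -
  have "bounded (range (\<lambda>n. q (s n)))"
    using \<open>bounded (range q)\<close> by (rule bounded_subset) auto
  then obtain p r1 where r1: "strict_mono (r1 :: nat \<Rightarrow> nat)" and p: "(\<lambda>n. q (s (r1 n))) \<longlonglongrightarrow> p"
    using bounded_imp_convergent_subsequence by (force simp: comp_def)
  obtain C where "\<And>k. tv_norm (\<mu> k) \<le> C"
    using tv_norm_\<mu>_bounded by metis
  then obtain r2 \<nu> m where r2: "strict_mono (r2 :: nat \<Rightarrow> nat)" and \<nu>: "is_smeasure \<Omega> \<nu>"
    "weakstar_conv \<Omega> (\<lambda>n. \<mu> (s (r1 (r2 n)))) \<nu>"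
    and m: "(\<lambda>n. tv_norm (\<mu> (s (r1 (r2 n))))) \<longlonglongrightarrow> m" "tv_norm \<nu> \<le> m"
    using smeasure_weakstar_subsequence[OF \<Omega>_open, of "\<lambda>n. \<mu> (s (r1 n))" C] is_smeasure_\<mu> by metis
  have t: "strict_mono (\<lambda>n. s (r1 (r2 n)))"
    by (intro strict_mono_compose[OF s] strict_mono_compose[OF r1] r2)
  have lim: "(\<lambda>n. q (s (r1 (r2 n)))) \<longlonglongrightarrow> p"
    using LIMSEQ_subseq_LIMSEQ[OF p r2] by (simp add: comp_def)
  have Jfun_lim: "(\<lambda>n. Jfun a f (\<mu> (s (r1 (r2 n))))) \<longlonglongrightarrow> val_P \<Omega> a f \<Omega>"
    using LIMSEQ_subseq_LIMSEQ[OF dual_cluster_point(2)[OF t lim] t] by (simp add: comp_def)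
  show thesis
    using that[OF strict_mono_compose[OF r1 r2] \<nu>(2) lim _ dual_cluster_point(1)[OF t lim] Jfun_lim]
      primal_cluster_point[OF \<nu> m Jfun_lim] by blast
qed

corollary weakstar_conv_unique_solution:
  assumes "bounded (range q)" and unique: "\<And>\<nu>. solves_P \<Omega> a f \<Omega> \<nu> \<Longrightarrow> \<nu> = \<nu>0"
  shows "weakstar_conv \<Omega> \<mu> \<nu>0"
  unfolding weakstar_conv_def
proof (intro ballI LIMSEQ_if_subseq_LIMSEQ)
  fix \<phi> and s :: "nat \<Rightarrow> nat" assume \<phi>: "\<phi> \<in> C0 \<Omega>" and s: "strict_mono s"
  obtain r \<nu> where "strict_mono (r :: nat \<Rightarrow> nat)" "weakstar_conv \<Omega> (\<lambda>n. \<mu> (s (r n))) \<nu>"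
    "solves_P \<Omega> a f \<Omega> \<nu>"
    using subsequence_converges_to_solutions[OF assms(1) s] by metis
  with unique \<phi> show "\<exists>r. strict_mono (r :: nat \<Rightarrow> nat) \<and>
      (\<lambda>n. sintegral \<phi> (\<mu> (s (r n)))) \<longlonglongrightarrow> sintegral \<phi> \<nu>0"
    by (auto simp: weakstar_conv_def)
qed

corollary LIMSEQ_unique_dual_solution:
  assumes "bounded (range q)" and unique: "\<And>p. solves_D a f \<Omega> p \<Longrightarrow> p = p0"
  shows "q \<longlonglongrightarrow> p0"
proof (rule LIMSEQ_if_subseq_LIMSEQ)
  fix s :: "nat \<Rightarrow> nat" assume s: "strict_mono s"
  obtain r p where "strict_mono (r :: nat \<Rightarrow> nat)" "(\<lambda>n. q (s (r n))) \<longlonglongrightarrow> p" "solves_D a f \<Omega> p"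
    using subsequence_converges_to_solutions[OF assms(1) s] by metis
  with unique show "\<exists>r. strict_mono (r :: nat \<Rightarrow> nat) \<and> (\<lambda>n. q (s (r n))) \<longlonglongrightarrow> p0"
    by (auto simp: comp_def)
qed

end

theorem mainTheorem1:
  fixes \<Omega> \<Omega>0 :: "'a::euclidean_space set"
    and a :: "'m::finite \<Rightarrow> 'a \<Rightarrow> real"
    and f :: "real^'m \<Rightarrow> ereal"
    and Om :: "nat \<Rightarrow> 'a set"
    and \<mu> :: "nat \<Rightarrow> 'a smeasure"
    and q :: "nat \<Rightarrow> real^'m"
  assumes \<Omega>_open: "open \<Omega>" and \<Omega>_ne: "\<Omega> \<noteq> {}"
    and a_C0: "\<forall>i. a i \<in> C0 \<Omega>"
    and f_proper: "proper_fun f" and f_convex: "convex_ext f" and f_lsc: "lsc_ext f"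
    and f_bdd: "\<exists>c::real. \<forall>y. ereal c \<le> f y"
    and \<Omega>0_sub: "\<Omega>0 \<subseteq> \<Omega>"
    and Om0: "Om 0 = \<Omega>0"
    and OmSuc: "\<forall>k. Om (Suc k) = Om k \<union> exch_X \<Omega> a (q k)"
    and \<mu>_sol: "\<forall>k. solves_P \<Omega> a f (Om k) (\<mu> k)"
    and q_sol: "\<forall>k. solves_D a f (Om k) (q k)"
    and standing_\<Omega>: "standing \<Omega> a f \<Omega>"
    and standing_k: "\<forall>k. standing \<Omega> a f (Om k)"
    and H: "(\<exists>g :: real^'m \<Rightarrow> real^'m. \<exists>L::real. L > 0 \<and> (\<forall>y. f y \<noteq> \<infinity>) \<and>
               (\<forall>y. ((\<lambda>z. real_of_ereal (f z)) has_derivative (\<lambda>h. g y \<bullet> h)) (at y)) \<and>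
               (\<forall>y z. norm (g y - g z) \<le> L * norm (y - z)))
          \<or> (\<forall>y. \<exists>\<nu> \<in> Meas \<Omega> \<Omega>0. opA a \<nu> = y)"
  shows "(\<exists>r::nat \<Rightarrow> nat. \<exists>\<mu>_lim q_lim. strict_mono r \<and>
            weakstar_conv \<Omega> (\<mu> \<circ> r) \<mu>_lim \<and> (q \<circ> r) \<longlonglongrightarrow> q_lim \<and>
            solves_P \<Omega> a f \<Omega> \<mu>_lim \<and> solves_D a f \<Omega> q_lim \<and>
            (\<lambda>n. Jfun a f (\<mu> (r n))) \<longlonglongrightarrow> Jfun a f \<mu>_lim \<and>
            Jfun a f \<mu>_lim = val_P \<Omega> a f \<Omega>)
       \<and> (\<forall>\<mu>'. (\<forall>\<nu>. solves_P \<Omega> a f \<Omega> \<nu> \<longleftrightarrow> \<nu> = \<mu>') \<longrightarrow> weakstar_conv \<Omega> \<mu> \<mu>')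
       \<and> (\<forall>q'. (\<forall>p. solves_D a f \<Omega> p \<longleftrightarrow> p = q') \<longrightarrow> q \<longlonglongrightarrow> q')"
proof -
  obtain c where "\<And>y. ereal c \<le> f y"
    using f_bdd by blast
  then interpret exchange_algorithm \<Omega> a f c Om \<mu> q
    using assms by unfold_locales auto
  have bounded: "bounded (range q)"
    using H
  proof (elim disjE exE conjE)
    fix g :: "real^'m \<Rightarrow> real^'m"
    assume "\<forall>y. f y \<noteq> \<infinity>" "\<forall>y. ((\<lambda>z. real_of_ereal (f z)) has_derivative (\<lambda>h. g y \<bullet> h)) (at y)"
    then show ?thesis
      by (intro bounded_range_q_if_continuous continuous_at_imp_continuous_on ballI)
        (auto intro: has_derivative_continuous)
  next
    assume "\<forall>y. \<exists>\<nu>\<in>Meas \<Omega> \<Omega>0. opA a \<nu> = y"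
    then show ?thesis
      by (intro bounded_range_q_if_opA_surj) (simp add: Om0)
  qed
  obtain r \<nu> p where "strict_mono (r :: nat \<Rightarrow> nat)" "weakstar_conv \<Omega> (\<lambda>n. \<mu> (r n)) \<nu>"
    "(\<lambda>n. q (r n)) \<longlonglongrightarrow> p" "solves_P \<Omega> a f \<Omega> \<nu>" "solves_D a f \<Omega> p"
    "(\<lambda>n. Jfun a f (\<mu> (r n))) \<longlonglongrightarrow> val_P \<Omega> a f \<Omega>"
    using subsequence_converges_to_solutions[OF bounded strict_mono_id, unfolded id_apply] by blast
  moreover from this have "Jfun a f \<nu> = val_P \<Omega> a f \<Omega>"
    by (simp add: solves_P_iff)
  ultimately show ?thesis
    unfolding comp_def
    using weakstar_conv_unique_solution[OF bounded] LIMSEQ_unique_dual_solution[OF bounded] by metis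
qed

end
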